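(* Let $n\geq 3$, fix $0<\rho<1$ and put $\delta:=\frac{n-2}{n}\rho$. Define, for $t\in[-1,1]$, \begin{align*} F(t) &:= \int_{-1}^{1} |\delta t-x| (1-x^2)^{\frac {n-3}{2}}\, dx,\\ G(t) &:= (n-2)\rho t \int_{-1}^{1} |\delta t-x| (1-x^2)^{\frac {n-3}{2}} x\, dx,\\ H(t) &:= \frac {2}{n^2-1} (1-\delta^2 t^2)^{\frac {n+1}{2}} \sum_{k=2}^{\infty} \frac {(k-2)!}{(n+2)_{k-2}} C_{k-2}^{\frac {n+2}{2}}(\delta t)\, C_{k}^{\frac {n-2}{2}}(t)\, \rho^{k}. \end{align*} Then the function $F+G+H$ is convex on $[-1,1]$.
   Context: $C_k^\lambda$ is the Gegenbauer polynomial of degree $k$ associated to $\lambda$, defined by $(1-2xz+z^2)^{-\lambda}=\sum_{k\ge0}C_k^\lambda(x)z^k$; $(a)_0=1$, $(a)_k=a(a+1)\cdots(a+k-1)$ is the Pochhammer symbol. *)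

theory Defs
  imports "HOL-Analysis.Analysis" "HOL-Computational_Algebra.Formal_Power_Series"
begin

text \<open>Gegenbauer polynomial C_k^lambda(x): the k-th coefficient of the generating
  function (1 - 2 x z + z^2)^(-lambda) = (1 + u)^(-lambda) with u = -2 x z + z^2,
  where (1+z)^a is the binomial series fps_binomial a.\<close>
definition gegenbauer :: "nat \<Rightarrow> real \<Rightarrow> real \<Rightarrow> real" where
  "gegenbauer k lam x =
     fps_nth (fps_binomial (- lam) oo (fps_const (-2 * x) * fps_X + fps_X ^ 2)) k"

end

theory Submission
  imports Defs
begin

text \<open>
  Write \<open>\<lambda> = (n - 2) / 2\<close>, \<open>x = \<delta> t\<close>, \<open>R\<^sup>2 = 1 - x\<^sup>2\<close>, and let \<open>P\<^sub>k\<close> be the Gegenbauer polynomial normalised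
  by \<open>P\<^sub>k(1) = 1\<close>. The derivative of \<open>(1 - x\<^sup>2)\<close>-weighted Gegenbauer polynomials lowers the parameter,
  while the derivative of unweighted ones raises it; hence differentiating \<open>F + G + H\<close> twice term by
  term gives \<open>2 R\<^bsup>n-3\<^esup>\<close> times the sum of the three series with terms
  \<open>P\<^sub>k(x) C\<^sub>k(t) \<rho>\<^sup>k\<close> for the parameters \<open>\<lambda>\<close>, \<open>\<lambda> + 1\<close>, \<open>\<lambda> + 2\<close>, with coefficients proportional to
  \<open>\<delta>\<^sup>2\<close>, \<open>- 2 \<delta> \<rho> R\<^sup>2\<close>, \<open>\<rho>\<^sup>2 R\<^sup>4\<close>. By the product formula each series is an integral of its generating
  function, and the sum becomes the integral over \<open>\<theta> \<in> [0, \<pi>]\<close> of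
  \<open>q\<^bsup>-\<lambda>\<^esup> (\<delta> - \<rho> R\<^sup>2 sin\<^sup>2 \<theta> / q)\<^sup>2 sin\<^bsup>n-3\<^esup> \<theta>\<close> with \<open>q = 1 - 2 \<rho> z + \<rho>\<^sup>2\<close> and
  \<open>z = x t + sqrt (1 - x\<^sup>2) sqrt (1 - t\<^sup>2) cos \<theta>\<close>, which is nonnegative.

  The product formula holds because, in the angle \<open>\<alpha>\<close> with \<open>t = cos \<alpha>\<close>, both sides solve the
  ultraspherical equation, whose energy \<open>v'\<^sup>2 + \<kappa> v\<^sup>2\<close> decreases from the poles to the equator.
  The same energy argument yields \<open>\<bar>C\<^sub>k(t)\<bar> \<le> C\<^sub>k(1)\<close>.
\<close>

section \<open>Gegenbauer polynomials\<close>

definition gegenbauer_fps :: "real \<Rightarrow> real \<Rightarrow> real fps" where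
  "gegenbauer_fps lam x = fps_binomial (- lam) oo (fps_const (-2 * x) * fps_X + fps_X ^ 2)"

definition gegenbauer_quad :: "real \<Rightarrow> real fps" where
  "gegenbauer_quad x = 1 + (fps_const (-2 * x) * fps_X + fps_X ^ 2)"

lemma fps_nth_gegenbauer_fps: "fps_nth (gegenbauer_fps lam x) k = gegenbauer k lam x"
  by (simp add: gegenbauer_fps_def gegenbauer_def)

text \<open>With u = -2xz + z^2 this is (1 + u)^(-lam) = (1 + u) (1 + u)^(-lam-1): exponents of
  binomial series add, and composition with u respects products.\<close>

lemma gegenbauer_fps_shift: "gegenbauer_fps lam x = gegenbauer_quad x * gegenbauer_fps (lam + 1) x"
proof -
  have "fps_binomial (- lam) = fps_binomial 1 * fps_binomial (- (lam + 1))"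
    by (simp flip: fps_binomial_add_mult)
  then show ?thesis
    by (simp add: gegenbauer_fps_def gegenbauer_quad_def fps_binomial_1
        fps_compose_mult_distrib fps_compose_add_distrib)
qed

text \<open>Chain rule in z: u' = -2 (x - z), and differentiating the binomial series lowers its
  exponent by one.\<close>

lemma fps_deriv_gegenbauer_fps:
  "fps_deriv (gegenbauer_fps lam x) =
     fps_const (2 * lam) * (fps_const x - fps_X) * gegenbauer_fps (lam + 1) x"
proof -
  let ?u = "fps_const (-2 * x) * fps_X + fps_X ^ 2 :: real fps"
  have "fps_binomial (- lam) = fps_binomial (- (lam + 1)) * (1 + fps_X)"
    by (simp flip: fps_binomial_add_mult fps_binomial_1)
  \<comment> \<open>\<open>fps_binomial_deriv\<close> contains a division by
    \<open>1 + fps_X\<close>, which cancels because this series is nonzero.\<close>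
  moreover have "(1 + fps_X :: real fps) \<noteq> 0"
    by (metis fps_binomial_1 fps_binomial_nth gbinomial_0(1) fps_zero_nth zero_neq_one)
  ultimately have "fps_deriv (fps_binomial (- lam)) = fps_const (- lam) * fps_binomial (- (lam + 1))"
    unfolding fps_binomial_deriv by (metis mult.assoc nonzero_mult_div_cancel_right)
  moreover have "fps_deriv ?u = fps_const (-2) * (fps_const x - fps_X)"
    by (simp add: power2_eq_square algebra_simps numeral_fps_const)
  moreover have "fps_const (- lam) * B * (fps_const (-2) * Y) = fps_const (2 * lam) * Y * B"
    for B Y :: "real fps"
  proof -
    have "fps_const (2 * lam) = fps_const (- lam) * fps_const (-2)" by simp
    then show ?thesis by (simp only: mult_ac)
  qed
  moreover have "(fps_const c * B) oo ?u = fps_const c * (B oo ?u)" for c B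
    by (simp add: fps_compose_mult_distrib)
  ultimately show ?thesis
    unfolding gegenbauer_fps_def by (subst fps_compose_deriv) simp_all
qed

lemma gegenbauer_shift:
  "gegenbauer (Suc (Suc k)) lam x = gegenbauer (Suc (Suc k)) (lam + 1) x
     - 2 * x * gegenbauer (Suc k) (lam + 1) x + gegenbauer k (lam + 1) x"
proof -
  have "fps_nth (gegenbauer_fps lam x) (Suc (Suc k)) =
    fps_nth (gegenbauer_quad x * gegenbauer_fps (lam + 1) x) (Suc (Suc k))"
    using gegenbauer_fps_shift by metis
  then show ?thesis
    by (simp add: gegenbauer_quad_def distrib_right fps_nth_gegenbauer_fps power2_eq_square mult.assoc)
qed

lemma gegenbauer_0 [simp]: "gegenbauer 0 lam x = 1"
  by (simp add: gegenbauer_def)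

text \<open>Coefficient comparison in the z-derivative of the generating function; the factor on the
  left is the eigenvalue of the Euler operator z d/dz.\<close>

lemma gegenbauer_theta:
  "real (Suc (Suc k)) * gegenbauer (Suc (Suc k)) lam x =
     2 * lam * (x * gegenbauer (Suc k) (lam + 1) x - gegenbauer k (lam + 1) x)"
proof -
  have "fps_nth (fps_deriv (gegenbauer_fps lam x)) (Suc k) =
    fps_nth (fps_const (2 * lam) * (fps_const x - fps_X) * gegenbauer_fps (lam + 1) x) (Suc k)"
    using fps_deriv_gegenbauer_fps by metis
  then show ?thesis
    by (simp add: fps_nth_gegenbauer_fps algebra_simps)
qed

lemma gegenbauer_1 [simp]: "gegenbauer (Suc 0) lam x = 2 * lam * x"
proof -
  have "fps_nth (fps_deriv (gegenbauer_fps lam x)) 0 =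
    fps_nth (fps_const (2 * lam) * (fps_const x - fps_X) * gegenbauer_fps (lam + 1) x) 0"
    using fps_deriv_gegenbauer_fps by metis
  then show ?thesis
    by (simp add: fps_nth_gegenbauer_fps algebra_simps)
qed

text \<open>Multiplying the z-derivative by 1 - 2xz + z^2 brings the parameter back to
  \<open>lam\<close>. This first-order equation yields the three-term recurrence and, later, the
  analytic value of the series.\<close>

lemma gegenbauer_fps_ode:
  "gegenbauer_quad x * fps_deriv (gegenbauer_fps lam x) =
     fps_const (2 * lam) * (fps_const x - fps_X) * gegenbauer_fps lam x"
  using fps_deriv_gegenbauer_fps[of lam x] gegenbauer_fps_shift[of lam x]
  by (simp add: mult_ac)

lemma gegenbauer_rec:
  "real (Suc (Suc k)) * gegenbauer (Suc (Suc k)) lam x =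
     2 * (real k + 1 + lam) * x * gegenbauer (Suc k) lam x - (real k + 2 * lam) * gegenbauer k lam x"
proof -
  have "fps_nth (gegenbauer_quad x * fps_deriv (gegenbauer_fps lam x)) (Suc k) =
     fps_nth (fps_const (2 * lam) * (fps_const x - fps_X) * gegenbauer_fps lam x) (Suc k)"
    using gegenbauer_fps_ode by metis
  then show ?thesis
    by (cases k)
       (simp_all add: gegenbauer_quad_def fps_nth_gegenbauer_fps power2_eq_square algebra_simps)
qed

lemma gegenbauer_minus: "gegenbauer k lam (- x) = (-1) ^ k * gegenbauer k lam x"
proof (induction k rule: induct_nat_012)
  case (ge2 k)
  define s where "s = (-1 :: real) ^ k"
  have "real (Suc (Suc k)) * gegenbauer (Suc (Suc k)) lam (- x) =
    real (Suc (Suc k)) * ((-1) ^ Suc (Suc k) * gegenbauer (Suc (Suc k)) lam x)"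
    using gegenbauer_rec[of k lam x] gegenbauer_rec[of k lam "- x"] ge2
    unfolding power_Suc s_def[symmetric] by algebra
  then show ?case
    by (subst (asm) mult_left_cancel) auto
qed auto

text \<open>At x = 1 the generating function is (1 - z)^(-2 lam). In terms of coefficients, the
  recurrence propagates the two-term relation (k+1) C_(k+1) = (2 lam + k) C_k.\<close>

lemma gegenbauer_at_1: "gegenbauer k lam 1 = pochhammer (2 * lam) k / fact k"
proof (induction k rule: induct_nat_012)
  case (ge2 k)
  have "real (Suc k) * gegenbauer (Suc k) lam 1 = (2 * lam + real k) * gegenbauer k lam 1"
    unfolding ge2 by (simp add: pochhammer_Suc del: of_nat_Suc)
  then have "real (Suc (Suc k)) * gegenbauer (Suc (Suc k)) lam 1 =
    (2 * lam + real (Suc k)) * gegenbauer (Suc k) lam 1"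
    using gegenbauer_rec[of k lam 1] unfolding of_nat_Suc by algebra
  then have "gegenbauer (Suc (Suc k)) lam 1 =
    (2 * lam + real (Suc k)) * gegenbauer (Suc k) lam 1 / real (Suc (Suc k))"
    by (simp add: field_simps del: of_nat_Suc)
  then show ?case
    unfolding ge2 by (simp add: pochhammer_Suc[of _ "Suc k"] mult_ac del: of_nat_Suc)
qed auto

section \<open>Differentiation in x and the ultraspherical equation\<close>

text \<open>Induction along the three-term recurrence: differentiating it leaves an identity that
  follows from \<open>gegenbauer_rec\<close> at \<open>lam + 1\<close> and
  \<open>gegenbauer_shift\<close>.\<close>

lemma has_field_derivative_gegenbauer:
  "((\<lambda>x. gegenbauer (Suc k) lam x) has_field_derivative 2 * lam * gegenbauer k (lam + 1) x) (at x)"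
proof (induction k rule: induct_nat_012)
  case 0
  show ?case by (auto intro!: derivative_eq_intros)
next
  case 1
  have eq: "gegenbauer (Suc (Suc 0)) lam = (\<lambda>x. (2 * (1 + lam) * x * (2 * lam * x) - 2 * lam) / 2)"
    using gegenbauer_rec[of 0 lam] by (simp add: fun_eq_iff mult.commute)
  show ?case
    unfolding eq by (auto intro!: derivative_eq_intros simp: algebra_simps)
next
  case (ge2 k)
  have eq: "gegenbauer (Suc (Suc (Suc k))) lam =
    (\<lambda>x. (2 * (real (Suc k) + 1 + lam) * x * gegenbauer (Suc (Suc k)) lam x -
       (real (Suc k) + 2 * lam) * gegenbauer (Suc k) lam x) / real (Suc (Suc (Suc k))))"
    using gegenbauer_rec[of "Suc k" lam] by (auto simp: fun_eq_iff field_simps)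
  have alg: "(2 * (real (Suc k) + 1 + lam) * (gegenbauer (Suc (Suc k)) lam x
        + x * (2 * lam * gegenbauer (Suc k) (lam + 1) x)) -
       (real (Suc k) + 2 * lam) * (2 * lam * gegenbauer k (lam + 1) x)) =
      2 * lam * gegenbauer (Suc (Suc k)) (lam + 1) x * real (Suc (Suc (Suc k)))"
    using gegenbauer_rec[of k "lam + 1" x] gegenbauer_shift[of k lam x]
    by simp algebra
  show ?case
    unfolding eq
    by (rule derivative_eq_intros ge2 refl | simp)+ (use alg in \<open>simp add: field_simps\<close>)
qed

lemma gegenbauer_theta':
  "(real (Suc k) + 2 * lam) * gegenbauer (Suc k) lam x =
     2 * lam * (gegenbauer (Suc k) (lam + 1) x - x * gegenbauer k (lam + 1) x)"
proof (cases k)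
  case 0
  then show ?thesis by (simp add: algebra_simps)
next
  case (Suc j)
  show ?thesis
    using gegenbauer_theta[of j lam x] gegenbauer_shift[of j lam x]
    unfolding Suc of_nat_Suc by algebra
qed

text \<open>This is (1 - x^2) y'' - (2 lam + 1) x y' + d (d + 2 lam) y = 0 for y = C_d^lam with d =
  k + 2, the derivatives being written as polynomials of parameter \<open>lam + 1\<close> and
  \<open>lam + 2\<close>.\<close>

lemma gegenbauer_ode:
  "(1 - x\<^sup>2) * (4 * lam * (lam + 1) * gegenbauer k (lam + 2) x)
     - (2 * lam + 1) * x * (2 * lam * gegenbauer (Suc k) (lam + 1) x)
     + real (k + 2) * (real (k + 2) + 2 * lam) * gegenbauer (Suc (Suc k)) lam x = 0"
proof -
  \<comment> \<open>With mu = lam + 1 this is (1 - x^2) (C_(k+1)^mu)' = (k + 2 mu) C_k^mu - (k + 1)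
    x C_(k+1)^mu. For k > 0 it comes from the two theta relations by eliminating
    C_(k-1)^(mu+1).\<close>
  have k: "2 * (lam + 1) * (1 - x\<^sup>2) * gegenbauer k (lam + 2) x
      + (real k + 1) * x * gegenbauer (Suc k) (lam + 1) x
      - (real k + 2 + 2 * lam) * gegenbauer k (lam + 1) x = 0"
  proof (cases k)
    case 0
    then show ?thesis by (simp add: algebra_simps power2_eq_square)
  next
    case (Suc j)
    have "lam + 1 + 1 = lam + 2" by simp
    show ?thesis
      using gegenbauer_theta[of j "lam + 1" x] gegenbauer_theta'[of j "lam + 1" x]
      unfolding Suc of_nat_Suc \<open>lam + 1 + 1 = lam + 2\<close> by algebra
  qed
  show ?thesis
    using k gegenbauer_theta[of k lam x] by simp algebra
qed

section \<open>The product formula\<close>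

lemma DERIV_gegenbauer [derivative_intros]:
  assumes "(f has_field_derivative f') (at x within S)"
  shows "((\<lambda>x. gegenbauer k lam (f x)) has_field_derivative
     (if k = 0 then 0 else 2 * lam * gegenbauer (k - 1) (lam + 1) (f x)) * f') (at x within S)"
proof (cases k)
  case (Suc j)
  show ?thesis
    using DERIV_chain2[OF has_field_derivative_gegenbauer[of j lam "f x"] assms] Suc by simp
qed simp

lemma continuous_on_gegenbauer [continuous_intros]:
  assumes "continuous_on S f"
  shows "continuous_on S (\<lambda>x. gegenbauer k lam (f x))"
proof -
  have "continuous_on UNIV (gegenbauer k lam)"
    by (rule DERIV_continuous_on) (rule DERIV_gegenbauer DERIV_ident)+
  then show ?thesis
    using continuous_on_compose2[OF _ assms] by blast
qed

section \<open>Energy estimate for the ultraspherical equation\<close>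

text \<open>The energy \<open>e\<close> has derivative -4 mu cot(a) v'^2, nonpositive between pole
  and equator. The equation is kept multiplied by \<open>sin a\<close> so that it makes sense at the
  pole, where it forces \<open>v' 0 = 0\<close>.\<close>

lemma ultraspherical_energy_aux:
  fixes v v' v'' :: "real \<Rightarrow> real"
  assumes v: "\<And>a. (v has_real_derivative v' a) (at a)"
    and v': "\<And>a. (v' has_real_derivative v'' a) (at a)"
    and ode: "\<And>a. sin a * v'' a + 2 * mu * cos a * v' a + \<kappa> * sin a * v a = 0"
    and "mu > 0" "\<kappa> > 0" "0 \<le> a" "a \<le> pi / 2"
  shows "\<bar>v a\<bar> \<le> \<bar>v 0\<bar>"
proof -
  define e where "e = (\<lambda>a. (v' a)\<^sup>2 + \<kappa> * (v a)\<^sup>2)"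
  have v'0: "v' 0 = 0"
    using ode[of 0] \<open>mu > 0\<close> by simp
  have "e a \<le> e 0"
  proof (rule DERIV_nonpos_imp_nonincreasing[OF \<open>0 \<le> a\<close>])
    fix b assume b: "0 \<le> b" "b \<le> a"
    have d: "(e has_real_derivative 2 * v' b * (v'' b + \<kappa> * v b)) (at b)"
      unfolding e_def by (rule derivative_eq_intros v v' refl | simp add: algebra_simps)+
    have "2 * v' b * (v'' b + \<kappa> * v b) \<le> 0"
    proof (cases "b = 0")
      case True
      then show ?thesis using v'0 by simp
    next
      case False
      with b assms have "sin b > 0" "cos b \<ge> 0"
        by (auto intro!: sin_gt_zero cos_ge_zero)
      have "sin b * (2 * v' b * (v'' b + \<kappa> * v b)) = - (4 * mu * cos b * (v' b)\<^sup>2)"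
        using ode[of b] by algebra
      also have "\<dots> \<le> 0"
        using \<open>mu > 0\<close> \<open>cos b \<ge> 0\<close> by simp
      finally show ?thesis
        using \<open>sin b > 0\<close> by (simp add: mult_le_0_iff)
    qed
    with d show "\<exists>y. (e has_real_derivative y) (at b) \<and> y \<le> 0" by blast
  qed
  then have "\<kappa> * (v a)\<^sup>2 \<le> \<kappa> * (v 0)\<^sup>2"
    using v'0 by (simp add: e_def) (smt (verit) zero_le_power2)
  then show ?thesis
    using \<open>\<kappa> > 0\<close> by (simp add: abs_le_square_iff)
qed

text \<open>The equation is invariant under the reflection a -> pi - a, so beyond the equator the
  estimate is started from the other pole.\<close>

lemma ultraspherical_energy:
  fixes v v' v'' :: "real \<Rightarrow> real"
  assumes v: "\<And>a. (v has_real_derivative v' a) (at a)"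
    and v': "\<And>a. (v' has_real_derivative v'' a) (at a)"
    and ode: "\<And>a. sin a * v'' a + 2 * mu * cos a * v' a + \<kappa> * sin a * v a = 0"
    and "mu > 0" "\<kappa> > 0" "0 \<le> a" "a \<le> pi"
  shows "\<bar>v a\<bar> \<le> max \<bar>v 0\<bar> \<bar>v pi\<bar>"
proof (cases "a \<le> pi / 2")
  case True
  then show ?thesis
    using ultraspherical_energy_aux[OF v v' ode] assms by (simp add: le_max_iff_disj)
next
  case False
  have "\<bar>v (pi - (pi - a))\<bar> \<le> \<bar>v (pi - 0)\<bar>"
  proof (rule ultraspherical_energy_aux[where v = "\<lambda>b. v (pi - b)" and v' = "\<lambda>b. - v' (pi - b)"
        and v'' = "\<lambda>b. v'' (pi - b)" and mu = mu and \<kappa> = \<kappa>])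
    fix b
    have d: "((\<lambda>b. pi - b) has_real_derivative - 1) (at b)"
      by (auto intro!: derivative_eq_intros)
    show "((\<lambda>b. v (pi - b)) has_real_derivative - v' (pi - b)) (at b)"
      using DERIV_chain2[OF v d] by simp
    show "((\<lambda>b. - v' (pi - b)) has_real_derivative v'' (pi - b)) (at b)"
      using DERIV_minus[OF DERIV_chain2[OF v' d]] by simp
    show "sin b * v'' (pi - b) + 2 * mu * cos b * - v' (pi - b) + \<kappa> * sin b * v (pi - b) = 0"
      using ode[of "pi - b"] by (simp add: cos_diff)
  qed (use assms False in auto)
  then show ?thesis by (simp add: le_max_iff_disj)
qed

section \<open>Spherical means of Gegenbauer polynomials\<close>

text \<open>By the spherical law of cosines the argument is the cosine of the side opposite the
  angle \<theta> enclosed by sides \<open>a\<close> and \<open>b\<close>, so this is an unnormalised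
  spherical mean of a zonal function. The exponent is m = 2 mu - 1 for the parameter mu.\<close>

definition gegenbauer_mean :: "nat \<Rightarrow> nat \<Rightarrow> real \<Rightarrow> real \<Rightarrow> real" where
  "gegenbauer_mean m k b a = integral {0..pi} (\<lambda>\<theta>.
     gegenbauer k ((real m + 1) / 2) (cos a * cos b + sin a * sin b * cos \<theta>) * sin \<theta> ^ m)"

text \<open>After differentiation under the integral sign, the left-hand side of the equation has as
  integrand an exact \<theta>-derivative of a function that vanishes at 0 and pi.\<close>

lemma gegenbauer_mean_ode:
  fixes m k :: nat and b :: real
  assumes "k > 0"
  defines "mu \<equiv> (real m + 1) / 2"
  shows "\<exists>u' u''. (\<forall>a. (gegenbauer_mean m k b has_real_derivative u' a) (at a)) \<and>
    (\<forall>a. (u' has_real_derivative u'' a) (at a)) \<and>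
    (\<forall>a. sin a * u'' a + 2 * mu * cos a * u' a
        + real k * (real k + 2 * mu) * sin a * gegenbauer_mean m k b a = 0)"
proof -
  define z where "z = (\<lambda>a \<theta>. cos a * cos b + sin a * sin b * cos \<theta>)"
  define z' where "z' = (\<lambda>a \<theta>. - sin a * cos b + cos a * sin b * cos \<theta>)"
  define g0 where "g0 = gegenbauer k mu"
  define g1 where "g1 = (\<lambda>x. 2 * mu * gegenbauer (k - 1) (mu + 1) x)"
  \<comment> \<open>For \<open>k = 1\<close> the truncated index \<open>k - 2\<close> is 0, which
    would give a nonzero constant instead of the vanishing second derivative.\<close>
  define g2 where "g2 = (\<lambda>x. if k = 1 then 0 else 4 * mu * (mu + 1) * gegenbauer (k - 2) (mu + 2) x)"
  have [simp]: "1 + mu + 1 = mu + 2" "mu + 1 + 1 = mu + 2" by simp_all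
  have dg0: "(g0 has_real_derivative g1 x) (at x)" for x
    unfolding g0_def g1_def using assms(1) by (auto intro!: derivative_eq_intros)
  have dg1: "(g1 has_real_derivative g2 x) (at x)" for x
    unfolding g1_def g2_def using assms(1)
    by (auto intro!: derivative_eq_intros simp: Suc_diff_Suc numeral_2_eq_2)
  have cg2: "continuous_on S g2" for S
    unfolding g2_def by (cases "k = 1") (auto intro!: continuous_intros)
  have cg0: "continuous_on S g0" and cg1: "continuous_on S g1" for S
    using dg0 dg1 by (auto intro!: DERIV_continuous_on intro: has_field_derivative_at_within)
  have g_ode: "(1 - x\<^sup>2) * g2 x - (2 * mu + 1) * x * g1 x + real k * (real k + 2 * mu) * g0 x = 0" for x
  proof (cases "k = 1")
    case True
    then show ?thesis by (simp add: g0_def g1_def g2_def algebra_simps)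
  next
    case False
    with assms(1) obtain j where j: "k = Suc (Suc j)"
      by (metis One_nat_def gr0_implies_Suc not0_implies_Suc)
    then show ?thesis
      using gegenbauer_ode[of x mu j] by (simp add: g0_def g1_def g2_def)
  qed
  have dz: "((\<lambda>a. z a \<theta>) has_real_derivative z' a \<theta>) (at a)" for a \<theta>
    unfolding z_def z'_def by (auto intro!: derivative_eq_intros)
  have dz': "((\<lambda>a. z' a \<theta>) has_real_derivative - z a \<theta>) (at a)" for a \<theta>
    unfolding z_def z'_def by (auto intro!: derivative_eq_intros)
  have dz\<theta>: "((\<lambda>\<theta>. z a \<theta>) has_real_derivative - sin a * sin b * sin \<theta>) (at \<theta>)" for a \<theta>
    unfolding z_def by (auto intro!: derivative_eq_intros)
  define h0 where "h0 = (\<lambda>a \<theta>. g0 (z a \<theta>) * sin \<theta> ^ m)"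
  define h1 where "h1 = (\<lambda>a \<theta>. g1 (z a \<theta>) * z' a \<theta> * sin \<theta> ^ m)"
  define h2 where "h2 = (\<lambda>a \<theta>. (g2 (z a \<theta>) * (z' a \<theta>)\<^sup>2 - g1 (z a \<theta>) * z a \<theta>) * sin \<theta> ^ m)"
  have dh0: "((\<lambda>a. h0 a \<theta>) has_real_derivative h1 a \<theta>) (at a)" for a \<theta>
    unfolding h0_def h1_def
    by (rule derivative_eq_intros DERIV_chain2[OF dg0] dz refl | simp)+
  have dh1: "((\<lambda>a. h1 a \<theta>) has_real_derivative h2 a \<theta>) (at a)" for a \<theta>
    unfolding h1_def h2_def
    by (rule derivative_eq_intros DERIV_chain2[OF dg1] dz dz' refl | simp add: algebra_simps power2_eq_square)+
  have cz: "continuous_on S (\<lambda>(a, \<theta>). z a \<theta>)" "continuous_on S (\<lambda>(a, \<theta>). z' a \<theta>)" for S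
    unfolding z_def z'_def case_prod_unfold by (intro continuous_intros)+
  have ch: "continuous_on S (\<lambda>(a, \<theta>). h0 a \<theta>)" "continuous_on S (\<lambda>(a, \<theta>). h1 a \<theta>)"
    "continuous_on S (\<lambda>(a, \<theta>). h2 a \<theta>)" for S
    using cz[of S] unfolding h0_def h1_def h2_def case_prod_unfold
    by (auto intro!: continuous_intros continuous_on_compose2[OF cg0[of UNIV]]
        continuous_on_compose2[OF cg1[of UNIV]] continuous_on_compose2[OF cg2[of UNIV]])
  have sect: "continuous_on {0..pi} (h a)" if "continuous_on UNIV (\<lambda>(a, \<theta>). h a \<theta>)"
    for h :: "real \<Rightarrow> real \<Rightarrow> real" and a
    using continuous_on_compose2[OF that continuous_on_Pair[OF continuous_on_const continuous_on_id]]
    by simp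
  have int: "h0 a integrable_on {0..pi}" "h1 a integrable_on {0..pi}" "h2 a integrable_on {0..pi}" for a
    by (intro integrable_continuous_interval sect ch)+
  define u1 where "u1 = (\<lambda>a. integral {0..pi} (h1 a))"
  define u2 where "u2 = (\<lambda>a. integral {0..pi} (h2 a))"
  have u0: "gegenbauer_mean m k b = (\<lambda>a. integral {0..pi} (h0 a))"
    by (simp add: fun_eq_iff gegenbauer_mean_def h0_def z_def g0_def mu_def)
  have d0: "(gegenbauer_mean m k b has_real_derivative u1 a) (at a)" for a
    unfolding u0 u1_def
    using leibniz_rule_field_derivative[where U = UNIV and a = 0 and b = pi and f = h0 and fx = h1 and ?x0.0 = a]
      dh0 int ch by (simp add: cbox_interval)
  have d1: "(u1 has_real_derivative u2 a) (at a)" for a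
    unfolding u1_def u2_def
    using leibniz_rule_field_derivative[where U = UNIV and a = 0 and b = pi and f = h1 and fx = h2 and ?x0.0 = a]
      dh1 int ch by (simp add: cbox_interval)
  have ode: "sin a * u2 a + 2 * mu * cos a * u1 a
        + real k * (real k + 2 * mu) * sin a * gegenbauer_mean m k b a = 0" for a
  proof -
    \<comment> \<open>The boundary term: it vanishes at both ends because of
      \<open>sin \<theta> ^ Suc m\<close>, and its exponent m + 1 = 2 mu produces the first-order
      coefficient of the equation.\<close>
    define E where "E = (\<lambda>\<theta>. sin b * sin \<theta> ^ Suc m * g1 (z a \<theta>))"
    define E' where "E' = (\<lambda>\<theta>. sin a * h2 a \<theta> + 2 * mu * cos a * h1 a \<theta>
        + real k * (real k + 2 * mu) * sin a * h0 a \<theta>)"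
    have dE: "(E has_real_derivative E' \<theta>) (at \<theta>)" for \<theta>
    proof -
      have "(E has_real_derivative sin b * ((real m + 1) * sin \<theta> ^ m * cos \<theta> * g1 (z a \<theta>)
          - sin \<theta> ^ Suc m * g2 (z a \<theta>) * sin a * sin b * sin \<theta>)) (at \<theta>)"
        unfolding E_def
        by (rule derivative_eq_intros DERIV_chain2[OF dg1] dz\<theta> refl | simp add: algebra_simps)+
      moreover have "sin b * ((real m + 1) * sin \<theta> ^ m * cos \<theta> * g1 (z a \<theta>)
          - sin \<theta> ^ Suc m * g2 (z a \<theta>) * sin a * sin b * sin \<theta>) = E' \<theta>"
      proof -
        have m: "real m + 1 = 2 * mu" by (simp add: mu_def)
        \<comment> \<open>The vector (\<open>z a \<theta>\<close>, \<open>z' a \<theta>\<close>,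
          \<open>sin b * sin \<theta>\<close>) is the unit vector (cos b, sin b cos \<theta>, sin b
          sin \<theta>) with its first two coordinates rotated through \<open>a\<close>. Rotating
          back gives \<open>c\<close>, the unit length gives \<open>q\<close>.\<close>
        have c: "cos a * z' a \<theta> + sin a * z a \<theta> = sin b * cos \<theta>"
          unfolding z_def z'_def using sin_cos_squared_add[of a] by algebra
        have q: "(z' a \<theta>)\<^sup>2 + (z a \<theta>)\<^sup>2 - 1 = - (sin b)\<^sup>2 * (sin \<theta>)\<^sup>2"
          unfolding z_def z'_def
          using sin_cos_squared_add[of a] sin_cos_squared_add[of b] sin_cos_squared_add[of \<theta>] by algebra
        have "E' \<theta> = sin \<theta> ^ m * (sin a * g2 (z a \<theta>) * ((z' a \<theta>)\<^sup>2 + (z a \<theta>)\<^sup>2 - 1)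
             + 2 * mu * g1 (z a \<theta>) * (cos a * z' a \<theta> + sin a * z a \<theta>))"
        proof -
          define s where "s = sin \<theta> ^ m"
          show ?thesis
            unfolding E'_def h0_def h1_def h2_def s_def[symmetric] using g_ode[of "z a \<theta>"] by algebra
        qed
        then show ?thesis
          unfolding c q m by (simp add: algebra_simps power2_eq_square)
      qed
      ultimately show ?thesis by simp
    qed
    have "(E' has_integral E pi - E 0) {0..pi}"
      by (rule fundamental_theorem_of_calculus)
         (auto intro: dE has_field_derivative_at_within simp flip: has_real_derivative_iff_has_vector_derivative)
    then have "integral {0..pi} E' = 0"
      by (simp add: E_def integral_unique)
    moreover have "integral {0..pi} E' = sin a * u2 a + 2 * mu * cos a * u1 a
        + real k * (real k + 2 * mu) * sin a * gegenbauer_mean m k b a"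
      unfolding E'_def u0 u1_def u2_def
      by (subst integral_add integral_mult_right; (intro integrable_add integrable_on_mult_right int)?)+
         simp
    ultimately show ?thesis by simp
  qed
  show ?thesis using d0 d1 ode by blast
qed

section \<open>Total masses of the averaging weights\<close>

definition sin_power_integral :: "nat \<Rightarrow> real" where
  "sin_power_integral m = integral {0..pi} (\<lambda>\<theta>. sin \<theta> ^ m)"

text \<open>The function -cos \<theta> sin^(m+1) \<theta> has increment zero over [0, pi]. The
  ratios obtained compare the weights belonging to \<open>lam\<close>, \<open>lam + 1\<close> and
  \<open>lam + 2\<close>.\<close>

lemma sin_power_integral_Suc_Suc:
  "(real m + 2) * sin_power_integral (m + 2) = (real m + 1) * sin_power_integral m"
proof -
  define E' where "E' = (\<lambda>\<theta>::real. (real m + 2) * sin \<theta> ^ (m + 2) - (real m + 1) * sin \<theta> ^ m)"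
  have "((\<lambda>\<theta>. - cos \<theta> * sin \<theta> ^ Suc m) has_real_derivative E' \<theta>) (at \<theta>)" for \<theta>
  proof -
    have "((\<lambda>\<theta>. - cos \<theta> * sin \<theta> ^ Suc m) has_real_derivative
        sin \<theta> * sin \<theta> ^ Suc m - (real m + 1) * (cos \<theta>)\<^sup>2 * sin \<theta> ^ m) (at \<theta>)"
      by (rule derivative_eq_intros refl | simp add: algebra_simps power2_eq_square)+
    moreover have "sin \<theta> * sin \<theta> ^ Suc m - (real m + 1) * (cos \<theta>)\<^sup>2 * sin \<theta> ^ m = E' \<theta>"
      unfolding E'_def cos_squared_eq by (simp add: algebra_simps power2_eq_square)
    ultimately show ?thesis by simp
  qed
  then have "(E' has_integral - cos pi * sin pi ^ Suc m - (- cos 0 * sin 0 ^ Suc m)) {0..pi}"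
    by (intro fundamental_theorem_of_calculus)
       (auto intro: has_field_derivative_at_within simp flip: has_real_derivative_iff_has_vector_derivative)
  then have "integral {0..pi} E' = 0"
    by (simp add: integral_unique)
  moreover have "integral {0..pi} E' =
      (real m + 2) * sin_power_integral (m + 2) - (real m + 1) * sin_power_integral m"
    unfolding E'_def sin_power_integral_def
    by (subst integral_diff) (auto intro!: integrable_continuous_interval continuous_intros)
  ultimately show ?thesis by simp
qed

lemma sin_power_integral_pos: "sin_power_integral m > 0"
proof -
  have c: "continuous_on {0..pi} (\<lambda>\<theta>::real. sin \<theta> ^ m)"
    by (intro continuous_intros)
  have nn: "sin_power_integral m \<ge> 0"
    unfolding sin_power_integral_def
    by (intro integral_nonneg integrable_continuous_interval c) (auto intro!: zero_le_power sin_ge_zero)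
  have "sin_power_integral m \<noteq> 0"
  proof
    assume "sin_power_integral m = 0"
    then have "((\<lambda>\<theta>::real. sin \<theta> ^ m) has_integral 0) {0..pi}"
      unfolding sin_power_integral_def
      by (metis c integrable_continuous_interval integrable_integral)
    moreover have "0 \<le> sin x ^ m" if "0 < x \<and> x < pi" for x :: real
      using that by (auto intro!: zero_le_power sin_ge_zero)
    ultimately have "sin (pi / 2) ^ m = 0"
      using has_integral_0_cbox_imp_0[of 0 pi "\<lambda>\<theta>::real. sin \<theta> ^ m" "pi / 2"] c pi_gt_zero
      by (auto simp: not_le)
    then show False by simp
  qed
  with nn show ?thesis by simp
qed

lemma gegenbauer_at_1_pos: "lam > 0 \<Longrightarrow> gegenbauer k lam 1 > 0"
  by (simp add: gegenbauer_at_1 pochhammer_pos)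

text \<open>At \<open>b = 0\<close> the integrand depends on \<theta> only through the weight. Hence
  \<open>gegenbauer_mean_ode\<close> also covers the polynomial itself as a function of the
  angle.\<close>

lemma gegenbauer_mean_0:
  "gegenbauer_mean m k 0 a = sin_power_integral m * gegenbauer k ((real m + 1) / 2) (cos a)"
  by (simp add: gegenbauer_mean_def sin_power_integral_def mult.commute)

text \<open>The energy bound applied to the polynomial in the angle; by parity both poles give the
  same absolute value C_k(1).\<close>

lemma gegenbauer_abs_le:
  fixes m :: nat
  assumes "\<bar>x\<bar> \<le> 1"
  defines "mu \<equiv> (real m + 1) / 2"
  shows "\<bar>gegenbauer k mu x\<bar> \<le> gegenbauer k mu 1"
proof (cases "k = 0")
  case False
  have mu: "mu > 0" by (simp add: mu_def)
  then have kappa: "real k * (real k + 2 * mu) > 0" using False by simp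
  have pos: "gegenbauer k mu 1 > 0"
    using mu by (rule gegenbauer_at_1_pos)
  obtain u' u'' where u: "\<And>a. (gegenbauer_mean m k 0 has_real_derivative u' a) (at a)"
    "\<And>a. (u' has_real_derivative u'' a) (at a)"
    "\<And>a. sin a * u'' a + 2 * mu * cos a * u' a
        + real k * (real k + 2 * mu) * sin a * gegenbauer_mean m k 0 a = 0"
    using gegenbauer_mean_ode[of k m 0] False unfolding mu_def by auto
  have "\<bar>gegenbauer_mean m k 0 (arccos x)\<bar> \<le>
      max \<bar>gegenbauer_mean m k 0 0\<bar> \<bar>gegenbauer_mean m k 0 pi\<bar>"
    by (rule ultraspherical_energy[OF u]) (use mu kappa assms(1) in \<open>auto intro!: arccos_lbound arccos_ubound\<close>)
  moreover have "\<bar>gegenbauer k mu (- 1)\<bar> = gegenbauer k mu 1"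
    using pos by (simp add: gegenbauer_minus abs_mult power_abs)
  ultimately have "sin_power_integral m * \<bar>gegenbauer k mu x\<bar> \<le> sin_power_integral m * gegenbauer k mu 1"
    using assms(1) pos sin_power_integral_pos[of m]
    by (simp add: gegenbauer_mean_0 abs_mult cos_arccos abs_le_iff flip: mu_def)
  then show ?thesis
    using sin_power_integral_pos[of m] by simp
qed simp

text \<open>The difference \<open>v\<close> of the two sides solves the linear equation and vanishes
  at both poles, at \<open>pi\<close> by parity; the energy bound then makes it zero.\<close>

lemma gegenbauer_product_angle:
  fixes m k :: nat
  assumes "0 \<le> a" "a \<le> pi"
  defines "mu \<equiv> (real m + 1) / 2"
  shows "gegenbauer_mean m k b a =
    sin_power_integral m * (gegenbauer k mu (cos b) / gegenbauer k mu 1) * gegenbauer k mu (cos a)"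
proof (cases "k = 0")
  case True
  then show ?thesis by (simp add: gegenbauer_mean_def sin_power_integral_def)
next
  case False
  have mu: "mu > 0" by (simp add: mu_def)
  then have kappa: "real k * (real k + 2 * mu) > 0" using False by simp
  have pos: "gegenbauer k mu 1 > 0"
    using mu by (rule gegenbauer_at_1_pos)
  define c where "c = gegenbauer k mu (cos b) / gegenbauer k mu 1"
  obtain u' u'' where u: "\<And>a. (gegenbauer_mean m k b has_real_derivative u' a) (at a)"
    "\<And>a. (u' has_real_derivative u'' a) (at a)"
    "\<And>a. sin a * u'' a + 2 * mu * cos a * u' a
        + real k * (real k + 2 * mu) * sin a * gegenbauer_mean m k b a = 0"
    using gegenbauer_mean_ode[of k m b] False unfolding mu_def by auto
  obtain w' w'' where w: "\<And>a. (gegenbauer_mean m k 0 has_real_derivative w' a) (at a)"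
    "\<And>a. (w' has_real_derivative w'' a) (at a)"
    "\<And>a. sin a * w'' a + 2 * mu * cos a * w' a
        + real k * (real k + 2 * mu) * sin a * gegenbauer_mean m k 0 a = 0"
    using gegenbauer_mean_ode[of k m 0] False unfolding mu_def by auto
  define v where "v = (\<lambda>a. gegenbauer_mean m k b a - c * gegenbauer_mean m k 0 a)"
  have mean_ends: "gegenbauer_mean m k b 0 = sin_power_integral m * gegenbauer k mu (cos b)"
    "gegenbauer_mean m k b pi = sin_power_integral m * gegenbauer k mu (- cos b)"
    by (simp_all add: gegenbauer_mean_def sin_power_integral_def mu_def mult.commute)
  have v0: "v 0 = 0" and vpi: "v pi = 0"
    using pos unfolding v_def mean_ends gegenbauer_mean_0 c_def
    by (simp_all add: gegenbauer_minus flip: mu_def)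
  have "\<bar>v a\<bar> \<le> max \<bar>v 0\<bar> \<bar>v pi\<bar>"
  proof (rule ultraspherical_energy)
    fix a
    show "(v has_real_derivative u' a - c * w' a) (at a)"
      unfolding v_def by (rule derivative_eq_intros u w refl | simp)+
    show "((\<lambda>a. u' a - c * w' a) has_real_derivative u'' a - c * w'' a) (at a)"
      by (rule derivative_eq_intros u w refl | simp)+
    show "sin a * (u'' a - c * w'' a) + 2 * mu * cos a * (u' a - c * w' a)
        + (real k * (real k + 2 * mu)) * sin a * v a = 0"
      unfolding v_def using u(3)[of a] w(3)[of a] by algebra
  qed (use mu kappa assms(1,2) in auto)
  then have "v a = 0"
    using v0 vpi by simp
  then show ?thesis
    by (simp add: v_def gegenbauer_mean_0 c_def flip: mu_def)
qed

lemma gegenbauer_product_formula: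
  fixes m k :: nat
  assumes "\<bar>x\<bar> \<le> 1" "\<bar>t\<bar> \<le> 1"
  defines "mu \<equiv> (real m + 1) / 2"
  shows "((\<lambda>\<theta>. gegenbauer k mu (x * t + sqrt (1 - x\<^sup>2) * sqrt (1 - t\<^sup>2) * cos \<theta>) * sin \<theta> ^ m) has_integral
    sin_power_integral m * (gegenbauer k mu x / gegenbauer k mu 1) * gegenbauer k mu t) {0..pi}"
proof -
  define f where "f = (\<lambda>\<theta>. gegenbauer k mu (x * t + sqrt (1 - x\<^sup>2) * sqrt (1 - t\<^sup>2) * cos \<theta>) * sin \<theta> ^ m)"
  have "integral {0..pi} f = gegenbauer_mean m k (arccos x) (arccos t)"
    using assms(1,2)
    by (simp add: gegenbauer_mean_def f_def mu_def sin_arccos_abs cos_arccos abs_le_iff mult_ac)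
  also have "\<dots> = sin_power_integral m * (gegenbauer k mu x / gegenbauer k mu 1) * gegenbauer k mu t"
    using assms(1,2) gegenbauer_product_angle[of "arccos t" m k "arccos x"]
    by (simp add: mu_def arccos_lbound arccos_ubound abs_le_iff)
  finally have "integral {0..pi} f = \<dots>" .
  moreover have "f integrable_on {0..pi}"
    unfolding f_def by (intro integrable_continuous_interval continuous_intros)
  ultimately show ?thesis
    unfolding f_def[symmetric] using integrable_integral[of f "{0..pi}"] by simp
qed

section \<open>The generating function\<close>

text \<open>This is the binomial series of (1 - r)^(-2 lam). Through
  \<open>gegenbauer_abs_le\<close> it serves as the dominating series in the comparisons
  below.\<close>

lemma summable_gegenbauer_at_1:
  assumes "\<bar>r\<bar> < 1"
  shows "summable (\<lambda>k. gegenbauer k lam 1 * r ^ k)"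
proof -
  have "(\<lambda>k. (- (2 * lam) gchoose k) * (- r) ^ k) sums (1 + - r) powr (- (2 * lam))"
    using assms by (intro Generalised_Binomial_Theorem.gen_binomial_real) simp
  moreover have "(- (2 * lam) gchoose k) * (- r) ^ k = gegenbauer k lam 1 * r ^ k" for k
  proof -
    have "(- r) ^ k = (-1) ^ k * r ^ k" by (simp flip: power_mult_distrib)
    then show ?thesis
      by (simp add: gbinomial_pochhammer gegenbauer_at_1 flip: power_mult_distrib)
  qed
  ultimately show ?thesis by (simp add: sums_iff)
qed

text \<open>Passage from the formal to the analytic identity: on [0, r] the sum \<open>E\<close> and
  the power of \<open>q\<close> solve the same first-order linear equation, so \<open>h\<close> is
  constant with value 1 at the origin.\<close>

lemma gegenbauer_generating_function:
  fixes m :: nat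
  assumes "\<bar>z\<bar> \<le> 1" "0 \<le> r" "r < 1"
  defines "mu \<equiv> (real m + 1) / 2"
  shows "(\<lambda>k. gegenbauer k mu z * r ^ k) sums ((1 - 2 * z * r + r\<^sup>2) powr (- mu))"
proof -
  define q where "q = (\<lambda>r. 1 - 2 * z * r + r\<^sup>2)"
  have q_pos: "q s > 0" if "0 \<le> s" "s < 1" for s
  proof -
    have "z * s \<le> 1 * s" using that assms by (intro mult_right_mono) auto
    moreover have "(1 - s)\<^sup>2 > 0" using that by simp
    ultimately show ?thesis by (simp add: q_def power2_eq_square algebra_simps)
  qed
  let ?f = "gegenbauer_fps mu z"
  have summ: "summable (\<lambda>k. gegenbauer k mu z * s ^ k)" if "0 \<le> s" "s < 1" for s
  proof (rule summable_comparison_test')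
    show "summable (\<lambda>k. gegenbauer k mu 1 * s ^ k)"
      using that by (intro summable_gegenbauer_at_1) simp
    show "norm (gegenbauer k mu z * s ^ k) \<le> gegenbauer k mu 1 * s ^ k" for k
      using gegenbauer_abs_le[OF assms(1), of k m] that
      by (simp add: abs_mult mu_def mult_right_mono)
  qed
  have "fps_conv_radius ?f \<ge> 1"
    unfolding fps_conv_radius_def fps_nth_gegenbauer_fps
  proof (rule conv_radius_geI_ex)
    fix s :: real assume "0 < s" "ereal s < 1"
    then show "\<exists>z'. norm z' = s \<and> summable (\<lambda>k. gegenbauer k mu z * z' ^ k)"
      by (intro exI[of _ s]) (auto intro!: summ)
  qed
  have conv: "ereal (norm s) < fps_conv_radius ?f" if "0 \<le> s" "s < 1" for s :: real
  proof -
    have "ereal (norm s) < 1" using that by simp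
    with \<open>fps_conv_radius ?f \<ge> 1\<close> show ?thesis by (rule less_le_trans[rotated])
  qed
  define E where "E = eval_fps ?f"
  define E' where "E' = eval_fps (fps_deriv ?f)"
  have dE: "(E has_real_derivative E' s) (at s)" if "0 \<le> s" "s < 1" for s
    unfolding E_def E'_def using conv[OF that] by (rule has_field_derivative_eval_fps)
  have ode: "q s * E' s = 2 * mu * (z - s) * E s" if "0 \<le> s" "s < 1" for s
  proof -
    \<comment> \<open>Both coefficients are polynomials, so the formal equation may be evaluated at
      \<open>s\<close> inside the radius of convergence of the series.\<close>
    have "gegenbauer_quad z = fps_of_poly [:1, - 2 * z, 1:]"
      by (simp add: gegenbauer_quad_def fps_of_poly_pCons power2_eq_square distrib_right add_ac)
    moreover have "fps_const (2 * mu) * (fps_const z - fps_X) = fps_of_poly [:2 * mu * z, - (2 * mu):]"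
      by (simp add: fps_of_poly_pCons right_diff_distrib flip: fps_const_neg)
    ultimately have "eval_fps (fps_of_poly [:1, - 2 * z, 1:] * fps_deriv ?f) s =
      eval_fps (fps_of_poly [:2 * mu * z, - (2 * mu):] * ?f) s"
      using gegenbauer_fps_ode[of z mu] by (simp only:)
    moreover have "ereal (norm s) < fps_conv_radius (fps_deriv ?f)"
      using conv[OF that] fps_conv_radius_deriv less_le_trans by blast
    ultimately show ?thesis
      using conv[OF that]
      by (simp add: eval_fps_mult E_def E'_def q_def power2_eq_square algebra_simps)
  qed
  define h where "h = (\<lambda>s. E s * q s powr mu)"
  have dh: "(h has_real_derivative 0) (at s)" if "0 \<le> s" "s < 1" for s
  proof -
    have "(h has_real_derivative E' s * q s powr mu + E s * (mu * q s powr (mu - 1) * (2 * s - 2 * z))) (at s)"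
      unfolding h_def q_def using q_pos[OF that]
      by (auto intro!: derivative_eq_intros dE[OF that] simp: q_def)
    moreover have "q s powr mu = q s * q s powr (mu - 1)"
      using q_pos[OF that] by (simp add: powr_mult_base)
    then have "E' s * q s powr mu + E s * (mu * q s powr (mu - 1) * (2 * s - 2 * z)) = 0"
      using ode[OF that] by algebra
    ultimately show ?thesis by simp
  qed
  have "h r = h 0"
  proof (cases "r = 0")
    case False
    with assms have "0 < r" by simp
    have c: "continuous_on {0..r} h"
    proof (rule DERIV_continuous_on)
      fix s assume "s \<in> {0..r}"
      then have "0 \<le> s" "s < 1" using assms(3) by auto
      then show "(h has_real_derivative 0) (at s within {0..r})"
        by (rule has_field_derivative_at_within[OF dh])
    qed
    have d: "(h has_real_derivative 0) (at s)" if "0 < s" "s < r" for s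
      by (rule dh) (use that assms(3) in auto)
    show ?thesis
      by (rule DERIV_isconst2[OF \<open>0 < r\<close> c d]) (use \<open>0 < r\<close> in auto)
  qed simp
  also have "h 0 = 1"
    by (simp add: h_def E_def q_def eval_fps_at_0 fps_nth_gegenbauer_fps)
  finally have "E r = q r powr (- mu)"
    using q_pos[OF assms(2,3)] by (simp add: h_def powr_minus field_simps)
  moreover have "(\<lambda>k. gegenbauer k mu z * r ^ k) sums E r"
    using summ[OF assms(2,3)] by (simp add: E_def eval_fps_def fps_nth_gegenbauer_fps summable_sums)
  ultimately show ?thesis by (simp add: q_def)
qed

text \<open>The tail of the dominating series at 1 bounds the error independently of
  \<open>z\<close>.\<close>

lemma gegenbauer_partial_sums_uniform:
  fixes m :: nat
  assumes "0 \<le> r" "r < 1"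
  defines "mu \<equiv> (real m + 1) / 2"
  obtains \<tau> :: "nat \<Rightarrow> real" where "\<tau> \<longlonglongrightarrow> 0"
    "\<And>N z. \<bar>z\<bar> \<le> 1 \<Longrightarrow>
       \<bar>(\<Sum>k<N. gegenbauer k mu z * r ^ k) - (1 - 2 * z * r + r\<^sup>2) powr (- mu)\<bar> \<le> \<tau> N"
proof -
  define c where "c = (\<lambda>k. gegenbauer k mu 1 * r ^ k)"
  have sc: "summable c"
    unfolding c_def using assms by (intro summable_gegenbauer_at_1) simp
  show thesis
  proof (rule that)
    show "(\<lambda>N. \<Sum>k. c (k + N)) \<longlonglongrightarrow> 0"
      using sc by (rule suminf_exist_split2)
  next
    fix N :: nat and z :: real
    assume z: "\<bar>z\<bar> \<le> 1"
    define f where "f = (\<lambda>k. gegenbauer k mu z * r ^ k)"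
    have s: "f sums ((1 - 2 * z * r + r\<^sup>2) powr (- mu))"
      unfolding f_def mu_def using z assms(1,2) by (rule gegenbauer_generating_function)
    have le: "norm (f (k + N)) \<le> c (k + N)" for k
      using gegenbauer_abs_le[OF z, of "k + N" m] assms(1)
      by (simp add: f_def c_def mu_def abs_mult mult_right_mono)
    have "(1 - 2 * z * r + r\<^sup>2) powr (- mu) = (\<Sum>k. f (k + N)) + (\<Sum>k<N. f k)"
      using s suminf_split_initial_segment[of f N] by (auto simp: sums_iff)
    moreover have "norm (\<Sum>k. f (k + N)) \<le> (\<Sum>k. c (k + N))"
      using sc by (intro norm_suminf_le le) (simp add: summable_iff_shift)
    ultimately show "\<bar>(\<Sum>k<N. gegenbauer k mu z * r ^ k) - (1 - 2 * z * r + r\<^sup>2) powr (- mu)\<bar>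
        \<le> (\<Sum>k. c (k + N))"
      by (simp add: f_def)
  qed
qed

section \<open>Positivity of the quadratic form, up to truncation\<close>

text \<open>A truncated version of the positivity, with an error uniform in \<open>x\<close> and
  \<open>t\<close>. The lengths N + 2, N + 1, N match because each derivative lowers the index by
  one; the fractions in \<open>p\<close> are ratios of sine integrals.\<close>

lemma gegenbauer_form_lower_bound:
  fixes p :: nat and \<delta> r :: real
  assumes r: "0 \<le> r" "r < 1"
  defines "lam \<equiv> (real p + 1) / 2"
  defines "P \<equiv> (\<lambda>k mu x. gegenbauer k mu x / gegenbauer k mu 1)"
  obtains \<epsilon> :: "nat \<Rightarrow> real" where "\<epsilon> \<longlonglongrightarrow> 0"
    "\<And>N x t. \<lbrakk>\<bar>x\<bar> \<le> 1; \<bar>t\<bar> \<le> 1\<rbrakk> \<Longrightarrow>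
      - \<epsilon> N \<le> \<delta>\<^sup>2 * (\<Sum>k<N+2. P k lam x * gegenbauer k lam t * r ^ k)
       - 2 * \<delta> * r * (1 - x\<^sup>2) * ((real p + 1) / (real p + 2))
           * (\<Sum>k<N+1. P k (lam + 1) x * gegenbauer k (lam + 1) t * r ^ k)
       + r\<^sup>2 * (1 - x\<^sup>2)\<^sup>2 * ((real p + 1) * (real p + 3) / ((real p + 2) * (real p + 4)))
           * (\<Sum>k<N. P k (lam + 2) x * gegenbauer k (lam + 2) t * r ^ k)"
proof -
  have l1: "lam + 1 = (real (p + 2) + 1) / 2" and l2: "lam + 2 = (real (p + 4) + 1) / 2"
    by (simp_all add: lam_def)
  obtain \<tau>0 where \<tau>0: "\<tau>0 \<longlonglongrightarrow> 0" "\<And>N z. \<bar>z\<bar> \<le> 1 \<Longrightarrow>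
       \<bar>(\<Sum>k<N. gegenbauer k lam z * r ^ k) - (1 - 2 * z * r + r\<^sup>2) powr (- lam)\<bar> \<le> \<tau>0 N"
    using gegenbauer_partial_sums_uniform[OF r, of p] unfolding lam_def by blast
  obtain \<tau>1 where \<tau>1: "\<tau>1 \<longlonglongrightarrow> 0" "\<And>N z. \<bar>z\<bar> \<le> 1 \<Longrightarrow>
       \<bar>(\<Sum>k<N. gegenbauer k (lam + 1) z * r ^ k) - (1 - 2 * z * r + r\<^sup>2) powr (- (lam + 1))\<bar> \<le> \<tau>1 N"
    using gegenbauer_partial_sums_uniform[OF r, of "p + 2"] unfolding l1 by blast
  obtain \<tau>2 where \<tau>2: "\<tau>2 \<longlonglongrightarrow> 0" "\<And>N z. \<bar>z\<bar> \<le> 1 \<Longrightarrow>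
       \<bar>(\<Sum>k<N. gegenbauer k (lam + 2) z * r ^ k) - (1 - 2 * z * r + r\<^sup>2) powr (- (lam + 2))\<bar> \<le> \<tau>2 N"
    using gegenbauer_partial_sums_uniform[OF r, of "p + 4"] unfolding l2 by blast
  \<comment> \<open>Each tail is weighted by a bound for its coefficient, since (1 - x^2) sin^2
    \<theta> lies between 0 and 1.\<close>
  define \<epsilon> where "\<epsilon> = (\<lambda>N. \<delta>\<^sup>2 * \<tau>0 (N + 2) + 2 * \<bar>\<delta>\<bar> * r * \<tau>1 (N + 1) + r\<^sup>2 * \<tau>2 N)"
  show thesis
  proof (rule that)
    show "\<epsilon> \<longlonglongrightarrow> 0"
      unfolding \<epsilon>_def
      by (rule tendsto_eq_intros LIMSEQ_ignore_initial_segment \<tau>0 \<tau>1 \<tau>2 refl | simp)+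
  next
    fix N :: nat and x t :: real
    assume xt: "\<bar>x\<bar> \<le> 1" "\<bar>t\<bar> \<le> 1"
    define I where "I = sin_power_integral p"
    have I: "I > 0" by (simp add: I_def sin_power_integral_pos)
    have I1: "sin_power_integral (p + 2) = I * ((real p + 1) / (real p + 2))"
      using sin_power_integral_Suc_Suc[of p] by (simp add: I_def field_simps)
    have I2: "sin_power_integral (p + 4) = I * ((real p + 1) * (real p + 3) / ((real p + 2) * (real p + 4)))"
    proof -
      have "(real p + 4) * sin_power_integral (p + 4) = (real p + 3) * sin_power_integral (p + 2)"
        using sin_power_integral_Suc_Suc[of "p + 2"] by (simp add: add_ac eval_nat_numeral)
      then have "sin_power_integral (p + 4) = (real p + 3) * sin_power_integral (p + 2) / (real p + 4)"
        by (simp add: nonzero_eq_divide_eq mult.commute)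
      then show ?thesis unfolding I1 by simp
    qed
    define R2 where "R2 = 1 - x\<^sup>2"
    have R2: "0 \<le> R2" "R2 \<le> 1"
      using xt by (simp_all add: R2_def abs_square_le_1)
    define z where "z = (\<lambda>\<theta>. x * t + sqrt (1 - x\<^sup>2) * sqrt (1 - t\<^sup>2) * cos \<theta>)"
    define A where "A = (\<lambda>mu N \<theta>. \<Sum>k<N. gegenbauer k mu (z \<theta>) * r ^ k)"
    define B where "B = (\<lambda>mu N. \<Sum>k<N. P k mu x * gegenbauer k mu t * r ^ k)"
    have z: "\<bar>z \<theta>\<bar> \<le> 1" for \<theta>
    proof -
      define X T where "X = sqrt (1 - x\<^sup>2)" and "T = sqrt (1 - t\<^sup>2)"
      have XT: "X\<^sup>2 = 1 - x\<^sup>2" "T\<^sup>2 = 1 - t\<^sup>2"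
        using xt by (simp_all add: X_def T_def abs_square_le_1)
      have "1 - (z \<theta>)\<^sup>2 = (T * sin \<theta>)\<^sup>2 + (x * T * cos \<theta> - X * t)\<^sup>2"
        unfolding z_def X_def[symmetric] T_def[symmetric]
        using XT sin_cos_squared_add[of \<theta>] by algebra
      then have "(z \<theta>)\<^sup>2 \<le> 1"
        by (smt (verit) zero_le_power2)
      then show ?thesis by (simp add: abs_square_le_1)
    qed
    have prod: "((\<lambda>\<theta>. A ((real m + 1) / 2) M \<theta> * sin \<theta> ^ m) has_integral
        sin_power_integral m * B ((real m + 1) / 2) M) {0..pi}" for m M
    proof -
      have "((\<lambda>\<theta>. \<Sum>k<M. r ^ k * (gegenbauer k ((real m + 1) / 2) (z \<theta>) * sin \<theta> ^ m)) has_integral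
        (\<Sum>k<M. r ^ k * (sin_power_integral m * (gegenbauer k ((real m + 1) / 2) x /
            gegenbauer k ((real m + 1) / 2) 1) * gegenbauer k ((real m + 1) / 2) t))) {0..pi}"
        unfolding z_def using xt
        by (intro has_integral_sum has_integral_mult_right gegenbauer_product_formula) auto
      then show ?thesis
        by (simp add: A_def B_def P_def sum_distrib_left sum_distrib_right mult_ac)
    qed
    \<comment> \<open>Raising the parameter by one raises the sine exponent by two. The surplus
      powers are moved into \<open>D\<close>, leaving the common weight
      \<open>sin \<theta> ^ p\<close>.\<close>
    define D where "D = (\<lambda>\<theta>. \<delta>\<^sup>2 * A lam (N + 2) \<theta> - 2 * \<delta> * r * (R2 * (sin \<theta>)\<^sup>2) * A (lam + 1) (N + 1) \<theta>
        + r\<^sup>2 * (R2 * (sin \<theta>)\<^sup>2)\<^sup>2 * A (lam + 2) N \<theta>)"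
    define S where "S = \<delta>\<^sup>2 * B lam (N + 2)
        - 2 * \<delta> * r * R2 * ((real p + 1) / (real p + 2)) * B (lam + 1) (N + 1)
        + r\<^sup>2 * R2\<^sup>2 * ((real p + 1) * (real p + 3) / ((real p + 2) * (real p + 4))) * B (lam + 2) N"
    have int_D: "((\<lambda>\<theta>. D \<theta> * sin \<theta> ^ p) has_integral I * S) {0..pi}"
    proof -
      have "((\<lambda>\<theta>. \<delta>\<^sup>2 * (A lam (N + 2) \<theta> * sin \<theta> ^ p)
          - 2 * \<delta> * r * R2 * (A (lam + 1) (N + 1) \<theta> * sin \<theta> ^ (p + 2))
          + r\<^sup>2 * R2\<^sup>2 * (A (lam + 2) N \<theta> * sin \<theta> ^ (p + 4))) has_integral
          \<delta>\<^sup>2 * (I * B lam (N + 2))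
          - 2 * \<delta> * r * R2 * (sin_power_integral (p + 2) * B (lam + 1) (N + 1))
          + r\<^sup>2 * R2\<^sup>2 * (sin_power_integral (p + 4) * B (lam + 2) N)) {0..pi}"
        using prod[of p "N + 2"] prod[of "p + 2" "N + 1"] prod[of "p + 4" N]
        unfolding l1[symmetric] l2[symmetric] lam_def[symmetric] I_def
        by (intro has_integral_add has_integral_diff has_integral_mult_right)
      moreover have "\<delta>\<^sup>2 * (I * B lam (N + 2))
          - 2 * \<delta> * r * R2 * (sin_power_integral (p + 2) * B (lam + 1) (N + 1))
          + r\<^sup>2 * R2\<^sup>2 * (sin_power_integral (p + 4) * B (lam + 2) N) = I * S"
        unfolding S_def I1 I2 by (simp add: algebra_simps)
      moreover have "(\<lambda>\<theta>. \<delta>\<^sup>2 * (A lam (N + 2) \<theta> * sin \<theta> ^ p)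
          - 2 * \<delta> * r * R2 * (A (lam + 1) (N + 1) \<theta> * sin \<theta> ^ (p + 2))
          + r\<^sup>2 * R2\<^sup>2 * (A (lam + 2) N \<theta> * sin \<theta> ^ (p + 4))) = (\<lambda>\<theta>. D \<theta> * sin \<theta> ^ p)"
      proof
        fix \<theta> :: real
        define s where "s = sin \<theta> ^ p"
        have pw: "sin \<theta> ^ (p + 4) = ((sin \<theta>)\<^sup>2)\<^sup>2 * sin \<theta> ^ p" "sin \<theta> ^ (p + 2) = (sin \<theta>)\<^sup>2 * sin \<theta> ^ p"
          by (simp_all add: power_add power2_eq_square power4_eq_xxxx mult_ac)
        show "\<delta>\<^sup>2 * (A lam (N + 2) \<theta> * sin \<theta> ^ p)
          - 2 * \<delta> * r * R2 * (A (lam + 1) (N + 1) \<theta> * sin \<theta> ^ (p + 2))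
          + r\<^sup>2 * R2\<^sup>2 * (A (lam + 2) N \<theta> * sin \<theta> ^ (p + 4)) = D \<theta> * sin \<theta> ^ p"
          unfolding pw D_def s_def[symmetric] by algebra
      qed
      ultimately show ?thesis by simp
    qed
    have D_ge: "- \<epsilon> N \<le> D \<theta>" for \<theta>
    proof -
      define q where "q = 1 - 2 * z \<theta> * r + r\<^sup>2"
      define y where "y = R2 * (sin \<theta>)\<^sup>2"
      have y: "0 \<le> y" "y \<le> 1"
        using R2 by (auto simp: y_def abs_square_le_1 intro!: mult_le_one)
      have q: "q > 0"
      proof -
        have "z \<theta> * r \<le> 1 * r" using r z[of \<theta>] by (intro mult_right_mono) auto
        moreover have "(1 - r)\<^sup>2 > 0" using r by simp
        ultimately show ?thesis by (simp add: q_def power2_eq_square algebra_simps)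
      qed
      \<comment> \<open>Factoring out the lowest of the three powers of \<open>q\<close> leaves q^2,
        q and 1, the coefficients of a binomial square.\<close>
      define w where "w = q powr (- (lam + 2))"
      have w: "w > 0" using q by (simp add: w_def)
      have "- (lam + 1) = 1 + - (lam + 2)" "- lam = 2 + - (lam + 2)" by simp_all
      then have w1: "q powr (- (lam + 1)) = q * w" and w0: "q powr (- lam) = q\<^sup>2 * w"
        using q powr_add[of q 1 "- (lam + 2)"] powr_add[of q 2 "- (lam + 2)"]
        unfolding w_def by (simp_all only: powr_one powr_numeral less_imp_le)
      have e0: "\<bar>A lam (N + 2) \<theta> - q\<^sup>2 * w\<bar> \<le> \<tau>0 (N + 2)"
        using \<tau>0(2)[OF z[of \<theta>], of "N + 2"] unfolding A_def q_def[symmetric] w0 .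
      have e1: "\<bar>A (lam + 1) (N + 1) \<theta> - q * w\<bar> \<le> \<tau>1 (N + 1)"
        using \<tau>1(2)[OF z[of \<theta>], of "N + 1"] unfolding A_def q_def[symmetric] w1 .
      have e2: "\<bar>A (lam + 2) N \<theta> - w\<bar> \<le> \<tau>2 N"
        using \<tau>2(2)[OF z[of \<theta>], of N] unfolding A_def q_def[symmetric] w_def[symmetric] .
      have b0: "\<bar>\<delta>\<^sup>2 * (A lam (N + 2) \<theta> - q\<^sup>2 * w)\<bar> \<le> \<delta>\<^sup>2 * \<tau>0 (N + 2)"
        unfolding abs_mult using e0 by (simp add: mult_left_mono)
      have b1: "\<bar>2 * \<delta> * r * y * (A (lam + 1) (N + 1) \<theta> - q * w)\<bar> \<le> 2 * \<bar>\<delta>\<bar> * r * \<tau>1 (N + 1)"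
      proof -
        have "\<bar>2 * \<delta> * r * y * (A (lam + 1) (N + 1) \<theta> - q * w)\<bar> =
            (2 * \<bar>\<delta>\<bar> * r) * (y * \<bar>A (lam + 1) (N + 1) \<theta> - q * w\<bar>)"
          using r y by (simp add: abs_mult)
        also have "\<dots> \<le> (2 * \<bar>\<delta>\<bar> * r) * (1 * \<tau>1 (N + 1))"
          using r y e1 by (intro mult_left_mono mult_mono) auto
        finally show ?thesis by simp
      qed
      have b2: "\<bar>r\<^sup>2 * y\<^sup>2 * (A (lam + 2) N \<theta> - w)\<bar> \<le> r\<^sup>2 * \<tau>2 N"
      proof -
        have "\<bar>r\<^sup>2 * y\<^sup>2 * (A (lam + 2) N \<theta> - w)\<bar> = r\<^sup>2 * (y\<^sup>2 * \<bar>A (lam + 2) N \<theta> - w\<bar>)"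
          by (simp add: abs_mult)
        also have "\<dots> \<le> r\<^sup>2 * (1 * \<tau>2 N)"
          using r y e2 by (intro mult_left_mono mult_mono) (auto simp: power_le_one)
        finally show ?thesis by simp
      qed
      \<comment> \<open>The generating functions of the three series combine to a perfect square.\<close>
      have "D \<theta> = \<delta>\<^sup>2 * (A lam (N + 2) \<theta> - q\<^sup>2 * w) - 2 * \<delta> * r * y * (A (lam + 1) (N + 1) \<theta> - q * w)
          + r\<^sup>2 * y\<^sup>2 * (A (lam + 2) N \<theta> - w) + w * (\<delta> * q - r * y)\<^sup>2"
        unfolding D_def y_def[symmetric] by algebra
      moreover have "w * (\<delta> * q - r * y)\<^sup>2 \<ge> 0"
        using w by simp
      ultimately show ?thesis
        using b0 b1 b2 unfolding \<epsilon>_def by linarith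
    qed
    \<comment> \<open>The pointwise bound is integrated against the nonnegative weight, whose mass
      \<open>I\<close> is then divided out.\<close>
    have "- \<epsilon> N * I \<le> I * S"
    proof (rule has_integral_le[OF _ int_D])
      show "((\<lambda>\<theta>. - \<epsilon> N * sin \<theta> ^ p) has_integral - \<epsilon> N * I) {0..pi}"
        unfolding I_def sin_power_integral_def
        by (intro has_integral_mult_right integrable_integral integrable_continuous_interval continuous_intros)
      show "- \<epsilon> N * sin \<theta> ^ p \<le> D \<theta> * sin \<theta> ^ p" if "\<theta> \<in> {0..pi}" for \<theta>
        using that D_ge by (intro mult_right_mono zero_le_power sin_ge_zero) auto
    qed
    then have "- \<epsilon> N \<le> S"
      using I by (metis mult.commute mult_le_cancel_left_pos)
    then show "- \<epsilon> N \<le> \<delta>\<^sup>2 * (\<Sum>k<N+2. P k lam x * gegenbauer k lam t * r ^ k)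
       - 2 * \<delta> * r * (1 - x\<^sup>2) * ((real p + 1) / (real p + 2))
           * (\<Sum>k<N+1. P k (lam + 1) x * gegenbauer k (lam + 1) t * r ^ k)
       + r\<^sup>2 * (1 - x\<^sup>2)\<^sup>2 * ((real p + 1) * (real p + 3) / ((real p + 2) * (real p + 4)))
           * (\<Sum>k<N. P k (lam + 2) x * gegenbauer k (lam + 2) t * r ^ k)"
      by (simp only: S_def B_def R2_def)
  qed
qed

section \<open>Convexity\<close>

text \<open>Splitting at \<open>a\<close> expresses the integral through \<Phi> and the first moment
  \<Psi>; the terms containing \<open>a * h a\<close> cancel on differentiation. A further
  derivative gives \<open>2 * h a\<close>.\<close>

lemma integral_abs_diff_derivative:
  fixes h :: "real \<Rightarrow> real"
  assumes h: "continuous_on {-1..1} h" and a: "-1 < a" "a < 1"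
  defines "\<Phi> \<equiv> (\<lambda>a. integral {-1..a} h)"
  shows "((\<lambda>a. integral {-1..1} (\<lambda>x. \<bar>a - x\<bar> * h x)) has_real_derivative 2 * \<Phi> a - \<Phi> 1) (at a)"
    and "(\<Phi> has_real_derivative h a) (at a)"
proof -
  have deriv: "((\<lambda>a. integral {-1..a} g) has_real_derivative g b) (at b)"
    if "continuous_on {-1..1} g" "-1 < b" "b < 1" for g :: "real \<Rightarrow> real" and b
    using integral_has_real_derivative[OF that(1), of b] that(2,3)
    by (simp add: at_within_Icc_at)
  show d: "(\<Phi> has_real_derivative h a) (at a)"
    unfolding \<Phi>_def by (rule deriv[OF h a])
  define \<Psi> where "\<Psi> = (\<lambda>a. integral {-1..a} (\<lambda>x. x * h x))"
  have xh: "continuous_on {-1..1} (\<lambda>x. x * h x)"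
    by (intro continuous_intros h)
  have dd: "(\<Psi> has_real_derivative a * h a) (at a)"
    unfolding \<Psi>_def by (rule deriv[OF xh a])
  have split: "integral {-1..1} (\<lambda>x. \<bar>b - x\<bar> * h x) = 2 * b * \<Phi> b - 2 * \<Psi> b + \<Psi> 1 - b * \<Phi> 1"
    if b: "b \<in> {-1<..<1}" for b
  proof -
    have int: "g integrable_on {c..d}" if "continuous_on {-1..1} g" "{c..d} \<subseteq> {-1..1}" for g :: "real \<Rightarrow> real" and c d
      using that by (intro integrable_continuous_interval continuous_on_subset[OF that(1)])
    have sub: "{-1..b} \<subseteq> {-1..1}" "{b..1} \<subseteq> {-1..1}" using b by auto
    have kc: "continuous_on {-1..1} (\<lambda>x. \<bar>b - x\<bar> * h x)"
      by (intro continuous_intros h)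
    have comb: "integral {-1..b} g + integral {b..1} g = integral {-1..1} g"
      if "continuous_on {-1..1} g" for g :: "real \<Rightarrow> real"
      using b by (intro Henstock_Kurzweil_Integration.integral_combine int that) auto
    have "integral {-1..b} (\<lambda>x. \<bar>b - x\<bar> * h x) = integral {-1..b} (\<lambda>x. b * h x - x * h x)"
      by (intro integral_cong) (auto simp: algebra_simps)
    also have "\<dots> = b * \<Phi> b - \<Psi> b"
      unfolding \<Phi>_def \<Psi>_def
      by (subst integral_diff) (auto intro!: int integrable_on_mult_right h xh sub)
    finally have 1: "integral {-1..b} (\<lambda>x. \<bar>b - x\<bar> * h x) = b * \<Phi> b - \<Psi> b" .
    have "integral {b..1} (\<lambda>x. \<bar>b - x\<bar> * h x) = integral {b..1} (\<lambda>x. x * h x - b * h x)"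
      by (intro integral_cong) (auto simp: algebra_simps)
    also have "\<dots> = integral {b..1} (\<lambda>x. x * h x) - b * integral {b..1} h"
      by (subst integral_diff) (auto intro!: int integrable_on_mult_right h xh sub)
    also have "\<dots> = (\<Psi> 1 - \<Psi> b) - b * (\<Phi> 1 - \<Phi> b)"
      using comb[OF h] comb[OF xh] by (simp add: \<Phi>_def \<Psi>_def flip: comb[OF h] comb[OF xh])
    finally have 2: "integral {b..1} (\<lambda>x. \<bar>b - x\<bar> * h x) = (\<Psi> 1 - \<Psi> b) - b * (\<Phi> 1 - \<Phi> b)" .
    show ?thesis
      using comb[OF kc] unfolding 1 2 by (simp add: algebra_simps)
  qed
  have "((\<lambda>b. 2 * b * \<Phi> b - 2 * \<Psi> b + \<Psi> 1 - b * \<Phi> 1) has_real_derivative 2 * \<Phi> a - \<Phi> 1) (at a)"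
    by (rule derivative_eq_intros d dd refl | simp)+
  then show "((\<lambda>a. integral {-1..1} (\<lambda>x. \<bar>a - x\<bar> * h x)) has_real_derivative 2 * \<Phi> a - \<Phi> 1) (at a)"
    by (rule has_field_derivative_transform_within_open[where S = "{-1<..<1}"]) (use a split in auto)
qed

lemma DERIV_sqrt_one_minus_square_power:
  assumes "\<bar>x\<bar> < 1"
  shows "((\<lambda>x. sqrt (1 - x\<^sup>2) ^ (p + 2)) has_real_derivative
    - (real p + 2) * x * sqrt (1 - x\<^sup>2) ^ p) (at x)"
proof -
  have pos: "1 - x\<^sup>2 > 0"
    using assms by (simp add: abs_square_less_1)
  show ?thesis
    by (rule derivative_eq_intros refl | use pos in \<open>simp add: field_simps\<close>)+
qed

text \<open>The antiderivative comes from \<open>DERIV_sqrt_one_minus_square_power\<close>, which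
  requires \<open>\<bar>x\<bar> < 1\<close>; hence the interior form of the fundamental theorem,
  with mere continuity at the ends.\<close>

lemma integral_id_times_sqrt_power:
  assumes "\<bar>a\<bar> \<le> 1"
  shows "integral {-1..a} (\<lambda>x. x * sqrt (1 - x\<^sup>2) ^ p) = - (sqrt (1 - a\<^sup>2) ^ (p + 2)) / (real p + 2)"
proof -
  define E where "E = (\<lambda>x. - (sqrt (1 - x\<^sup>2) ^ (p + 2)) / (real p + 2))"
  have "((\<lambda>x. x * sqrt (1 - x\<^sup>2) ^ p) has_integral E a - E (-1)) {-1..a}"
  proof (rule fundamental_theorem_of_calculus_interior)
    show "continuous_on {-1..a} E"
      unfolding E_def by (intro continuous_intros) simp
    fix x assume "x \<in> {-1<..<a}"
    then have "\<bar>x\<bar> < 1" using assms by auto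
    then have "(E has_real_derivative - (- (real p + 2) * x * sqrt (1 - x\<^sup>2) ^ p) / (real p + 2)) (at x)"
      unfolding E_def by (intro DERIV_cdivide DERIV_minus DERIV_sqrt_one_minus_square_power)
    moreover have "- (- (real p + 2) * x * sqrt (1 - x\<^sup>2) ^ p) / (real p + 2) = x * sqrt (1 - x\<^sup>2) ^ p"
      by (simp add: field_simps)
    ultimately show "(E has_vector_derivative x * sqrt (1 - x\<^sup>2) ^ p) (at x)"
      by (simp add: has_real_derivative_iff_has_vector_derivative)
  qed (use assms in auto)
  then show ?thesis
    by (simp add: integral_unique E_def)
qed

text \<open>The ultraspherical equation for y = C_(k+1)^mu in self-adjoint form: (R^(2 mu + 1) y')'
  is a multiple of R^(2 mu - 1) y, with R^2 = 1 - x^2 and 2 mu - 1 = p. Normalising at 1 makes the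
  factor independent of \<open>k\<close>.\<close>

lemma DERIV_weighted_gegenbauer:
  fixes p k :: nat
  assumes x: "\<bar>x\<bar> < 1"
  defines "mu \<equiv> (real p + 1) / 2"
  shows "((\<lambda>x. sqrt (1 - x\<^sup>2) ^ (p + 2) * (gegenbauer k (mu + 1) x / gegenbauer k (mu + 1) 1))
     has_real_derivative - (real p + 2) * (sqrt (1 - x\<^sup>2) ^ p *
       (gegenbauer (Suc k) mu x / gegenbauer (Suc k) mu 1))) (at x)"
proof -
  define c d where "c = gegenbauer k (mu + 1) 1" and "d = gegenbauer (Suc k) mu 1"
  have mu: "mu > 0" by (simp add: mu_def)
  have c: "c > 0" and d: "d > 0"
    using mu by (auto simp: c_def d_def intro!: gegenbauer_at_1_pos)
  define g' where "g' = (\<lambda>x. if k = 0 then 0 else 2 * (mu + 1) * gegenbauer (k - 1) (mu + 2) x)"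
  have ode: "(1 - y\<^sup>2) * (2 * mu * g' y) - (2 * mu + 1) * y * (2 * mu * gegenbauer k (mu + 1) y)
      + real (Suc k) * (real (Suc k) + 2 * mu) * gegenbauer (Suc k) mu y = 0" for y
  proof (cases k)
    case 0
    then show ?thesis by (simp add: g'_def algebra_simps)
  next
    case (Suc j)
    then show ?thesis
      using gegenbauer_ode[of y mu j] by (simp add: g'_def algebra_simps)
  qed
  \<comment> \<open>At 1 the second-order term of the equation drops out, which leaves the ratio of
    the two normalising constants.\<close>
  have e1: "(2 * mu + 1) * (2 * mu) * c = real (Suc k) * (real (Suc k) + 2 * mu) * d"
    using ode[of 1] by (simp add: c_def d_def algebra_simps)
  have key: "(1 - x\<^sup>2) * (g' x / c) - (2 * mu + 1) * x * (gegenbauer k (mu + 1) x / c)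
      = - (2 * mu + 1) * (gegenbauer (Suc k) mu x / d)"
  proof -
    define K G C where "K = real (Suc k) * (real (Suc k) + 2 * mu)"
      and "G = gegenbauer k (mu + 1) x" and "C = gegenbauer (Suc k) mu x"
    have "2 * mu * ((1 - x\<^sup>2) * g' x - (2 * mu + 1) * x * G) = - (K * C)"
      using ode[of x] unfolding K_def[symmetric] G_def[symmetric] C_def[symmetric] by argo
    then have "2 * mu * ((1 - x\<^sup>2) * g' x - (2 * mu + 1) * x * G) * d = - (K * d) * C"
      by simp
    also have "\<dots> = 2 * mu * (- (2 * mu + 1) * c * C)"
      using e1 unfolding K_def[symmetric] by algebra
    finally have "((1 - x\<^sup>2) * g' x - (2 * mu + 1) * x * G) * d = - (2 * mu + 1) * c * C"
      using mu by simp
    then have "((1 - x\<^sup>2) * g' x - (2 * mu + 1) * x * G) / c = - (2 * mu + 1) * C / d"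
      using c d by (simp add: frac_eq_eq mult_ac)
    then show ?thesis by (simp add: diff_divide_distrib G_def C_def)
  qed
  have R2: "sqrt (1 - x\<^sup>2) ^ (p + 2) = sqrt (1 - x\<^sup>2) ^ p * (1 - x\<^sup>2)"
    using x by (simp add: power_add abs_square_le_1)
  have "(gegenbauer k (mu + 1) has_real_derivative g' x) (at x)"
    using DERIV_gegenbauer[OF DERIV_ident, of k "mu + 1" x UNIV]
    by (simp only: g'_def add.assoc one_add_one mult_1_right)
  then have "((\<lambda>x. sqrt (1 - x\<^sup>2) ^ (p + 2) * (gegenbauer k (mu + 1) x / c)) has_real_derivative
      - (real p + 2) * x * sqrt (1 - x\<^sup>2) ^ p * (gegenbauer k (mu + 1) x / c)
      + g' x / c * sqrt (1 - x\<^sup>2) ^ (p + 2)) (at x)"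
    by (intro DERIV_mult DERIV_cdivide DERIV_sqrt_one_minus_square_power x)
  moreover have "- (real p + 2) * x * sqrt (1 - x\<^sup>2) ^ p * (gegenbauer k (mu + 1) x / c)
      + g' x / c * sqrt (1 - x\<^sup>2) ^ (p + 2) =
      - (real p + 2) * (sqrt (1 - x\<^sup>2) ^ p * (gegenbauer (Suc k) mu x / d))"
  proof -
    define S where "S = sqrt (1 - x\<^sup>2) ^ p"
    have m: "real p + 2 = 2 * mu + 1" by (simp add: mu_def)
    show ?thesis
      unfolding R2 m S_def[symmetric] using key by algebra
  qed
  ultimately show ?thesis
    by (simp add: c_def d_def)
qed

section \<open>Limits of convex functions and assembly of the result\<close>

lemma convex_on_limit:
  fixes f :: "nat \<Rightarrow> 'a::real_vector \<Rightarrow> real"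
  assumes "\<And>N. convex_on S (f N)" "\<And>x. x \<in> S \<Longrightarrow> (\<lambda>N. f N x) \<longlonglongrightarrow> g x"
  shows "convex_on S g"
proof -
  have S: "convex S"
    using assms(1) by (simp add: convex_on_def)
  show ?thesis
    unfolding convex_on_def
  proof (intro conjI S ballI allI impI)
    fix x y and u v :: real
    assume xy: "x \<in> S" "y \<in> S" "0 \<le> u" "0 \<le> v" "u + v = 1"
    then have "u *\<^sub>R x + v *\<^sub>R y \<in> S"
      using S by (simp add: convex_def)
    then have "(\<lambda>N. f N (u *\<^sub>R x + v *\<^sub>R y)) \<longlonglongrightarrow> g (u *\<^sub>R x + v *\<^sub>R y)"
      by (rule assms(2))
    moreover have "(\<lambda>N. u * f N x + v * f N y) \<longlonglongrightarrow> u * g x + v * g y"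
      using xy by (intro tendsto_intros assms(2))
    moreover have "f N (u *\<^sub>R x + v *\<^sub>R y) \<le> u * f N x + v * f N y" for N
      using assms(1)[of N] xy by (simp add: convex_on_def)
    ultimately show "g (u *\<^sub>R x + v *\<^sub>R y) \<le> u * g x + v * g y"
      by (blast intro: LIMSEQ_le)
  qed
qed

text \<open>The series starts at index 2; the second derivatives of the \<open>J0\<close> and
  \<open>J1\<close> terms supply the missing low-order terms of the quadratic form. Since
  \<open>\<bar>\<delta>\<bar> < 1\<close>, the point \<open>\<delta> * t\<close> stays where the
  weights are differentiable.\<close>

lemma convex_on_gegenbauer_expansion:
  fixes p :: nat and \<delta> r :: real
  assumes r: "0 \<le> r" "r < 1" and \<delta>: "\<bar>\<delta>\<bar> < 1"
  defines "lam \<equiv> (real p + 1) / 2"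
  defines "P \<equiv> (\<lambda>k mu x. gegenbauer k mu x / gegenbauer k mu 1)"
  defines "J0 \<equiv> (\<lambda>a. integral {-1..1} (\<lambda>x. \<bar>a - x\<bar> * sqrt (1 - x\<^sup>2) ^ p))"
  defines "J1 \<equiv> (\<lambda>a. integral {-1..1} (\<lambda>x. \<bar>a - x\<bar> * (x * sqrt (1 - x\<^sup>2) ^ p)))"
  shows "convex_on {-1..1} (\<lambda>t. J0 (\<delta> * t) + (real p + 1) * r * t * J1 (\<delta> * t)
     + 2 / ((real p + 2) * (real p + 4)) * sqrt (1 - (\<delta> * t)\<^sup>2) ^ (p + 4) *
       (\<Sum>j. P j (lam + 2) (\<delta> * t) * gegenbauer (j + 2) lam t * r ^ (j + 2)))"
proof -
  define R where "R = (\<lambda>x::real. sqrt (1 - x\<^sup>2))"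
  \<comment> \<open>The weights are chosen so that, up to constants, \<open>U2 k\<close> has
    derivative \<open>U1 (k + 1)\<close> and \<open>U1 k\<close> has derivative
    \<open>U0 (k + 1)\<close>; in \<open>t\<close>, the polynomials produce \<open>C1\<close> and
    then \<open>C2\<close>.\<close>
  define U0 where "U0 = (\<lambda>k x. R x ^ p * P k lam x)"
  define U1 where "U1 = (\<lambda>k x. R x ^ (p + 2) * P k (lam + 1) x)"
  define U2 where "U2 = (\<lambda>k x. R x ^ (p + 4) * P k (lam + 2) x)"
  define c where "c = 2 / ((real p + 2) * (real p + 4))"
  define C1 where "C1 = (\<lambda>j t. (real p + 1) * gegenbauer (j + 1) (lam + 1) t)"
  define C2 where "C2 = (\<lambda>j t. (real p + 1) * (real p + 3) * gegenbauer j (lam + 2) t)"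
  define h where "h = (\<lambda>j t. c * r ^ (j + 2) * (U2 j (\<delta> * t) * gegenbauer (j + 2) lam t))"
  define h' where "h' = (\<lambda>j t. c * r ^ (j + 2) *
      (U2 j (\<delta> * t) * C1 j t - (real p + 4) * \<delta> * U1 (j + 1) (\<delta> * t) * gegenbauer (j + 2) lam t))"
  define h'' where "h'' = (\<lambda>j t. c * r ^ (j + 2) *
      (U2 j (\<delta> * t) * C2 j t - 2 * (real p + 4) * \<delta> * U1 (j + 1) (\<delta> * t) * C1 j t
       + (real p + 4) * (real p + 2) * \<delta>\<^sup>2 * U0 (j + 2) (\<delta> * t) * gegenbauer (j + 2) lam t))"
  \<comment> \<open>\<open>V\<close> is minus the derivative of \<open>J1\<close>: the odd integrand
    has total integral zero and an explicit antiderivative.\<close>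
  define V where "V = (\<lambda>x. 2 / (real p + 2) * R x ^ (p + 2))"
  define \<Phi> where "\<Phi> = (\<lambda>a. integral {-1..a} (\<lambda>x. R x ^ p))"
  define g where "g = (\<lambda>t. J0 (\<delta> * t) + (real p + 1) * r * t * J1 (\<delta> * t))"
  define g' where "g' = (\<lambda>t. \<delta> * (2 * \<Phi> (\<delta> * t) - \<Phi> 1)
     + (real p + 1) * r * (J1 (\<delta> * t) - t * \<delta> * V (\<delta> * t)))"
  define g'' where "g'' = (\<lambda>t. 2 * \<delta>\<^sup>2 * R (\<delta> * t) ^ p + (real p + 1) * r *
      (2 * t * \<delta>\<^sup>2 * (\<delta> * t) * R (\<delta> * t) ^ p - 2 * \<delta> * V (\<delta> * t)))"
  have \<delta>t: "\<bar>\<delta> * t\<bar> < 1" if "t \<in> {-1..1}" for t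
  proof -
    have "\<bar>\<delta>\<bar> * \<bar>t\<bar> \<le> \<bar>\<delta>\<bar> * 1"
      using that by (intro mult_left_mono) auto
    then show ?thesis using \<delta> by (simp add: abs_mult)
  qed
  have d\<delta>: "((\<lambda>t. \<delta> * t) has_real_derivative \<delta>) (at t)" for t
    by (auto intro!: derivative_eq_intros)
  have chain: "((\<lambda>t. f (\<delta> * t)) has_real_derivative f' * \<delta>) (at t)"
    if "(f has_real_derivative f') (at (\<delta> * t))" for f f' t
    using DERIV_chain2[OF that d\<delta>] .
  have dU2: "(U2 k has_real_derivative - (real p + 4) * U1 (k + 1) x) (at x)" if "\<bar>x\<bar> < 1" for k x
    using DERIV_weighted_gegenbauer[OF that, of "p + 2" k]
    by (simp add: U1_def U2_def R_def P_def lam_def add_divide_distrib add_ac eval_nat_numeral)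
  have dU1: "(U1 k has_real_derivative - (real p + 2) * U0 (k + 1) x) (at x)" if "\<bar>x\<bar> < 1" for k x
    using DERIV_weighted_gegenbauer[OF that, of p k]
    by (simp add: U0_def U1_def R_def P_def lam_def)
  have dC: "((\<lambda>t. gegenbauer (j + 2) lam t) has_real_derivative C1 j t) (at t)" for j t
  proof -
    have "2 * lam = real p + 1" by (simp add: lam_def)
    then show ?thesis
      using has_field_derivative_gegenbauer[of "j + 1" lam t] by (simp add: C1_def)
  qed
  have dC1: "(C1 j has_real_derivative C2 j t) (at t)" for j t
  proof -
    have "(C1 j has_real_derivative (real p + 1) * (2 * (lam + 1) * gegenbauer j (lam + 1 + 1) t)) (at t)"
      unfolding C1_def using has_field_derivative_gegenbauer[of j "lam + 1" t]
      by (intro DERIV_cmult) simp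
    moreover have "lam + 1 + 1 = lam + 2" "2 * (lam + 1) = real p + 3"
      by (simp_all add: lam_def)
    ultimately show ?thesis
      unfolding C2_def by (simp only: mult.assoc)
  qed
  have dh: "(h j has_real_derivative h' j t) (at t)" if "t \<in> {-1..1}" for j t
    unfolding h_def h'_def
    by ((rule chain[OF dU2] \<delta>t[OF that] dC derivative_eq_intros refl)+) (simp add: algebra_simps)
  have dh': "(h' j has_real_derivative h'' j t) (at t)" if "t \<in> {-1..1}" for j t
    unfolding h'_def h''_def
    by ((rule chain[OF dU2] chain[OF dU1] \<delta>t[OF that] dC dC1 derivative_eq_intros refl)+) (simp add: algebra_simps power2_eq_square)
  have cR: "continuous_on {-1..1} (\<lambda>x. R x ^ p)" "continuous_on {-1..1} (\<lambda>x. x * R x ^ p)"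
    unfolding R_def by (intro continuous_intros)+
  have dJ0: "(J0 has_real_derivative 2 * \<Phi> x - \<Phi> 1) (at x)"
    and d\<Phi>: "(\<Phi> has_real_derivative R x ^ p) (at x)" if "\<bar>x\<bar> < 1" for x
    using integral_abs_diff_derivative[OF cR(1), of x] that
    by (auto simp: J0_def \<Phi>_def R_def abs_less_iff)
  have dJ1: "(J1 has_real_derivative - V x) (at x)" if "\<bar>x\<bar> < 1" for x
  proof -
    have "(J1 has_real_derivative 2 * integral {-1..x} (\<lambda>x. x * R x ^ p) - integral {-1..1} (\<lambda>x. x * R x ^ p)) (at x)"
      using integral_abs_diff_derivative(1)[OF cR(2), of x] that
      by (auto simp: J1_def R_def abs_less_iff)
    then show ?thesis
      using integral_id_times_sqrt_power[of x p] integral_id_times_sqrt_power[of 1 p] that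
      by (simp add: R_def V_def)
  qed
  have dV: "(V has_real_derivative - 2 * x * R x ^ p) (at x)" if "\<bar>x\<bar> < 1" for x
  proof -
    have "2 / (real p + 2) * (- (real p + 2) * x * R x ^ p) = - 2 * x * R x ^ p"
      by (simp add: field_simps)
    then show ?thesis
      using DERIV_cmult[OF DERIV_sqrt_one_minus_square_power[OF that, of p], of "2 / (real p + 2)"]
      unfolding V_def R_def by (simp only:)
  qed
  have dg: "(g has_real_derivative g' t) (at t)" if "t \<in> {-1..1}" for t
    unfolding g_def g'_def
    by ((rule chain[OF dJ0] chain[OF dJ1] \<delta>t[OF that] derivative_eq_intros refl)+) (simp add: algebra_simps)
  have dg': "(g' has_real_derivative g'' t) (at t)" if "t \<in> {-1..1}" for t
    unfolding g'_def g''_def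
    by ((rule chain[OF d\<Phi>] chain[OF dJ1] chain[OF dV] \<delta>t[OF that] derivative_eq_intros refl)+)
       (simp add: algebra_simps power2_eq_square)
  obtain \<epsilon> where \<epsilon>: "\<epsilon> \<longlonglongrightarrow> 0" and form: "\<And>N x t. \<lbrakk>\<bar>x\<bar> \<le> 1; \<bar>t\<bar> \<le> 1\<rbrakk> \<Longrightarrow>
      - \<epsilon> N \<le> \<delta>\<^sup>2 * (\<Sum>k<N+2. P k lam x * gegenbauer k lam t * r ^ k)
       - 2 * \<delta> * r * (1 - x\<^sup>2) * ((real p + 1) / (real p + 2))
           * (\<Sum>k<N+1. P k (lam + 1) x * gegenbauer k (lam + 1) t * r ^ k)
       + r\<^sup>2 * (1 - x\<^sup>2)\<^sup>2 * ((real p + 1) * (real p + 3) / ((real p + 2) * (real p + 4)))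
           * (\<Sum>k<N. P k (lam + 2) x * gegenbauer k (lam + 2) t * r ^ k)"
    using gegenbauer_form_lower_bound[OF r, where p = p and \<delta> = \<delta>] unfolding lam_def P_def by blast
  \<comment> \<open>The second derivative of the partial sum is 2 R^p times the truncated form
    \<open>T\<close>; as R^p lies in [0, 1], the bound is uniform in \<open>t\<close>.\<close>
  have lower: "g'' t + (\<Sum>j<N. h'' j t) \<ge> - 2 * \<bar>\<epsilon> N\<bar>" if t: "t \<in> {-1..1}" for N t
  proof -
    define x where "x = \<delta> * t"
    have x: "\<bar>x\<bar> < 1" using \<delta>t[OF t] by (simp add: x_def)
    then have x2: "0 \<le> 1 - x\<^sup>2" by (simp add: abs_square_le_1)
    have Rp: "R x ^ (p + 2) = R x ^ p * (1 - x\<^sup>2)" "R x ^ (p + 4) = R x ^ p * (1 - x\<^sup>2)\<^sup>2"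
    proof -
      have "(R x)\<^sup>2 = 1 - x\<^sup>2" using x2 by (simp add: R_def)
      moreover have "R x ^ 4 = ((R x)\<^sup>2)\<^sup>2" by simp
      ultimately show "R x ^ (p + 2) = R x ^ p * (1 - x\<^sup>2)" "R x ^ (p + 4) = R x ^ p * (1 - x\<^sup>2)\<^sup>2"
        by (simp_all only: power_add)
    qed
    define A0 A1 A2 where "A0 = (\<lambda>k. P k lam x * gegenbauer k lam t * r ^ k)"
      and "A1 = (\<lambda>k. P k (lam + 1) x * gegenbauer k (lam + 1) t * r ^ k)"
      and "A2 = (\<lambda>k. P k (lam + 2) x * gegenbauer k (lam + 2) t * r ^ k)"
    define b1 where "b1 = 2 * \<delta> * r * (1 - x\<^sup>2) * ((real p + 1) / (real p + 2))"
    define b2 where "b2 = r\<^sup>2 * (1 - x\<^sup>2)\<^sup>2 * ((real p + 1) * (real p + 3) / ((real p + 2) * (real p + 4)))"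
    define T where "T = \<delta>\<^sup>2 * (\<Sum>k<N+2. A0 k) - b1 * (\<Sum>k<N+1. A1 k) + b2 * (\<Sum>k<N. A2 k)"
    have T: "- \<epsilon> N \<le> T"
      unfolding T_def A0_def A1_def A2_def b1_def b2_def by (rule form) (use x t in auto)
    have h''_eq: "h'' j t = 2 * R x ^ p * (\<delta>\<^sup>2 * A0 (j + 2) - b1 * A1 (j + 1) + b2 * A2 j)" for j
    proof -
      define e f where "e = (real p + 1) / (real p + 2)"
        and "f = (real p + 1) * (real p + 3) / ((real p + 2) * (real p + 4))"
      define p1 p2 p3 p4 where "p1 = real p + 1" and "p2 = real p + 2" and "p3 = real p + 3" and "p4 = real p + 4"
      define s \<sigma> where "s = R x ^ p" and "\<sigma> = r ^ j"
      have rj: "r ^ (j + 2) = r ^ j * r\<^sup>2" "r ^ (j + 1) = r ^ j * r"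
        by (simp_all only: power_add power_one_right)
      have "p2 \<noteq> 0" "p4 \<noteq> 0" "c = 2 / (p2 * p4)" "e = p1 / p2" "f = p1 * p3 / (p2 * p4)"
        by (simp_all add: c_def e_def f_def p1_def p2_def p3_def p4_def)
      then have k: "c * p4 * p2 = 2" "c * p4 * p1 = 2 * e" "c * p1 * p3 = 2 * f"
        by simp_all
      have "c * (\<sigma> * r\<^sup>2) * (s * X\<^sup>2 * Q2 * (p1 * p3 * G2) - 2 * p4 * \<delta> * (s * X * Q1) * (p1 * G1)
            + p4 * p2 * \<delta>\<^sup>2 * (s * Q0) * G0) =
          2 * s * (\<delta>\<^sup>2 * (Q0 * G0 * (\<sigma> * r\<^sup>2)) - 2 * \<delta> * r * X * e * (Q1 * G1 * (\<sigma> * r))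
            + r\<^sup>2 * X\<^sup>2 * f * (Q2 * G2 * \<sigma>))" for X Q0 Q1 Q2 G0 G1 G2
      proof -
        have "c * (\<sigma> * r\<^sup>2) * (s * X\<^sup>2 * Q2 * (p1 * p3 * G2) - 2 * p4 * \<delta> * (s * X * Q1) * (p1 * G1)
            + p4 * p2 * \<delta>\<^sup>2 * (s * Q0) * G0) =
          \<sigma> * r\<^sup>2 * s * (X\<^sup>2 * Q2 * G2 * (c * p1 * p3) - 2 * \<delta> * X * Q1 * G1 * (c * p4 * p1)
            + \<delta>\<^sup>2 * Q0 * G0 * (c * p4 * p2))"
          by (simp add: algebra_simps)
        then show ?thesis
          unfolding k by (simp add: algebra_simps power2_eq_square)
      qed
      then show ?thesis
        unfolding h''_def U0_def U1_def U2_def C1_def C2_def A0_def A1_def A2_def b1_def b2_def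
          x_def[symmetric] Rp rj e_def[symmetric] f_def[symmetric]
        unfolding p1_def[symmetric] p2_def[symmetric] p3_def[symmetric] p4_def[symmetric] s_def[symmetric] \<sigma>_def[symmetric] .
    qed
    \<comment> \<open>These are the terms of indices 0 and 1 of the first series and of index 0 of
      the second, exactly those that the sum of the \<open>h'' j\<close> omits.\<close>
    have "g'' t = 2 * R x ^ p * (\<delta>\<^sup>2 * (A0 0 + A0 1) - b1 * A1 0)"
      unfolding g''_def x_def[symmetric] V_def Rp A0_def A1_def b1_def
      by (simp add: P_def lam_def field_simps)
    moreover have "(\<Sum>k<N+2. A0 k) = A0 0 + A0 1 + (\<Sum>j<N. A0 (j + 2))"
      by (simp add: sum.lessThan_Suc_shift del: sum.lessThan_Suc)
    moreover have "(\<Sum>k<N+1. A1 k) = A1 0 + (\<Sum>j<N. A1 (j + 1))"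
      by (simp add: sum.lessThan_Suc_shift del: sum.lessThan_Suc)
    moreover have "(\<Sum>j<N. h'' j t) = 2 * R x ^ p * (\<delta>\<^sup>2 * (\<Sum>j<N. A0 (j + 2))
        - b1 * (\<Sum>j<N. A1 (j + 1)) + b2 * (\<Sum>j<N. A2 j))"
      unfolding h''_eq by (simp add: sum_subtractf sum.distrib flip: sum_distrib_left)
    ultimately have eq: "g'' t + (\<Sum>j<N. h'' j t) = 2 * R x ^ p * T"
      by (simp only: T_def) (simp add: algebra_simps)
    have R01: "0 \<le> R x ^ p" "R x ^ p \<le> 1"
      using x2 by (auto simp: R_def intro!: power_le_one)
    have "- (R x ^ p * T) \<le> R x ^ p * \<bar>\<epsilon> N\<bar>"
      using T R01(1) by (subst mult_minus_right[symmetric], intro mult_left_mono) auto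
    also have "\<dots> \<le> 1 * \<bar>\<epsilon> N\<bar>"
      using R01(2) by (rule mult_right_mono) simp
    finally show ?thesis unfolding eq by linarith
  qed
  \<comment> \<open>The quadratic term makes the partial sums convex, so the series need not be differentiated.\<close>
  define f where "f = (\<lambda>N t. g t + (\<Sum>j<N. h j t) + \<bar>\<epsilon> N\<bar> * t\<^sup>2)"
  show ?thesis
  proof (rule convex_on_limit)
    fix N
    show "convex_on {-1..1} (f N)"
    proof (rule f''_ge0_imp_convex)
      fix t :: real assume t: "t \<in> {-1..1}"
      show "(f N has_real_derivative g' t + (\<Sum>j<N. h' j t) + \<bar>\<epsilon> N\<bar> * (2 * t)) (at t)"
        unfolding f_def
        by (intro DERIV_add DERIV_sum dg dh t DERIV_cmult) (auto intro!: derivative_eq_intros)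
      show "((\<lambda>t. g' t + (\<Sum>j<N. h' j t) + \<bar>\<epsilon> N\<bar> * (2 * t)) has_real_derivative
          g'' t + (\<Sum>j<N. h'' j t) + \<bar>\<epsilon> N\<bar> * 2) (at t)"
        by (intro DERIV_add DERIV_sum dg' dh' t DERIV_cmult) (auto intro!: derivative_eq_intros)
      show "0 \<le> g'' t + (\<Sum>j<N. h'' j t) + \<bar>\<epsilon> N\<bar> * 2"
        using lower[OF t, of N] by simp
    qed simp
  next
    fix t :: real assume t: "t \<in> {-1..1}"
    define a where "a = (\<lambda>j. P j (lam + 2) (\<delta> * t) * gegenbauer (j + 2) lam t * r ^ (j + 2))"
    \<comment> \<open>Convergence identifies the limit of the partial sums with the infinite sum;
      the normalised factor is at most 1 in absolute value, the other at most its value at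
      1.\<close>
    have "summable (\<lambda>j. gegenbauer (j + 2) lam 1 * r ^ (j + 2))"
      using summable_gegenbauer_at_1[of r lam] r by (intro summable_ignore_initial_segment) simp
    then have "summable a"
    proof (rule summable_comparison_test'[where N = 0])
      fix j :: nat
      have "\<bar>gegenbauer j (lam + 2) (\<delta> * t)\<bar> \<le> gegenbauer j (lam + 2) 1"
        using gegenbauer_abs_le[of "\<delta> * t" j "p + 4"] \<delta>t[OF t]
        by (simp add: lam_def add_divide_distrib add_ac)
      moreover have "lam + 2 > 0" by (simp add: lam_def add_pos_pos)
      then have "gegenbauer j (lam + 2) 1 > 0" by (rule gegenbauer_at_1_pos)
      ultimately have "\<bar>P j (lam + 2) (\<delta> * t)\<bar> \<le> 1"
        by (simp add: P_def)
      moreover have "\<bar>gegenbauer (j + 2) lam t\<bar> \<le> gegenbauer (j + 2) lam 1"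
        using gegenbauer_abs_le[of t "j + 2" p] t by (simp add: lam_def abs_le_iff)
      ultimately have "\<bar>P j (lam + 2) (\<delta> * t)\<bar> * \<bar>gegenbauer (j + 2) lam t\<bar> \<le> 1 * gegenbauer (j + 2) lam 1"
        by (intro mult_mono) auto
      then show "norm (a j) \<le> gegenbauer (j + 2) lam 1 * r ^ (j + 2)"
        using r by (simp add: a_def abs_mult mult_right_mono)
    qed
    then have lim: "(\<lambda>N. \<Sum>j<N. a j) \<longlonglongrightarrow> suminf a"
      by (rule summable_LIMSEQ)
    have hs: "(\<Sum>j<N. h j t) = c * R (\<delta> * t) ^ (p + 4) * (\<Sum>j<N. a j)" for N
      by (simp add: h_def U2_def a_def sum_distrib_left mult_ac)
    have "(\<lambda>N. f N t) \<longlonglongrightarrow> g t + c * R (\<delta> * t) ^ (p + 4) * suminf a + \<bar>0\<bar> * t\<^sup>2"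
      unfolding f_def hs by (intro tendsto_intros lim \<epsilon>)
    then show "(\<lambda>N. f N t) \<longlonglongrightarrow> J0 (\<delta> * t) + (real p + 1) * r * t * J1 (\<delta> * t)
       + 2 / ((real p + 2) * (real p + 4)) * sqrt (1 - (\<delta> * t)\<^sup>2) ^ (p + 4) *
       (\<Sum>j. P j (lam + 2) (\<delta> * t) * gegenbauer (j + 2) lam t * r ^ (j + 2))"
      by (simp add: g_def c_def R_def a_def)
  qed
qed

lemma powr_half_of_nat: "y > 0 \<Longrightarrow> y powr (real k / 2) = sqrt y ^ k"
  by (simp add: powr_half_sqrt[symmetric] powr_powr flip: powr_realpow)

theorem theorem1p2:
  fixes n :: nat and \<rho> :: real
  assumes "n \<ge> 3" and "0 < \<rho>" and "\<rho> < 1"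
  defines "\<delta> \<equiv> (real n - 2) / real n * \<rho>"
  defines "F \<equiv> (\<lambda>t. integral {-1..1}
              (\<lambda>x. \<bar>\<delta> * t - x\<bar> * (1 - x^2) powr ((real n - 3) / 2)))"
  defines "G \<equiv> (\<lambda>t. (real n - 2) * \<rho> * t * integral {-1..1}
              (\<lambda>x. \<bar>\<delta> * t - x\<bar> * (1 - x^2) powr ((real n - 3) / 2) * x))"
  defines "H \<equiv> (\<lambda>t. 2 / ((real n)^2 - 1) * (1 - \<delta>^2 * t^2) powr ((real n + 1) / 2) *
              (\<Sum>j. (let k = j + 2 in
                 fact (k - 2) / pochhammer (real n + 2) (k - 2)
                 * gegenbauer (k - 2) ((real n + 2) / 2) (\<delta> * t)
                 * gegenbauer k ((real n - 2) / 2) t * \<rho> ^ k)))"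
  shows "convex_on {-1..1} (\<lambda>t. F t + G t + H t)"
proof -
  define p where "p = n - 3"
  have n: "real n = real p + 3"
    using assms(1) by (simp add: p_def)
  define lam where "lam = (real p + 1) / 2"
  have "0 \<le> (real n - 2) / real n" "(real n - 2) / real n \<le> 1"
    using assms(1) by (auto simp: field_simps)
  then have "0 \<le> \<delta>" "\<delta> \<le> 1 * \<rho>"
    unfolding \<delta>_def using assms(2) by (intro mult_nonneg_nonneg mult_right_mono; simp)+
  then have \<delta>: "\<bar>\<delta>\<bar> < 1" using assms(3) by simp
  \<comment> \<open>At the end points the two weights differ when \<open>n = 3\<close>: \<open>0 powr 0 = 0\<close>, but \<open>0 ^ 0 = 1\<close>.\<close>
  have w: "(1 - x\<^sup>2) powr ((real n - 3) / 2) = sqrt (1 - x\<^sup>2) ^ p" if "x \<in> {-1..1} - {-1, 1}" for x :: real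
  proof -
    have "\<bar>x\<bar> < 1" using that by auto
    then have "1 - x\<^sup>2 > 0" by (simp add: abs_square_less_1)
    then show ?thesis using powr_half_of_nat[of "1 - x\<^sup>2" p] by (simp add: n)
  qed
  have F: "F t = integral {-1..1} (\<lambda>x. \<bar>\<delta> * t - x\<bar> * sqrt (1 - x\<^sup>2) ^ p)" for t
    unfolding F_def by (rule integral_spike[where S = "{-1, 1}"]) (simp_all add: w)
  have G: "G t = (real p + 1) * \<rho> * t * integral {-1..1} (\<lambda>x. \<bar>\<delta> * t - x\<bar> * (x * sqrt (1 - x\<^sup>2) ^ p))" for t
  proof -
    have "integral {-1..1} (\<lambda>x. \<bar>\<delta> * t - x\<bar> * (1 - x^2) powr ((real n - 3) / 2) * x) =
        integral {-1..1} (\<lambda>x. \<bar>\<delta> * t - x\<bar> * (x * sqrt (1 - x\<^sup>2) ^ p))"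
      by (rule integral_spike[where S = "{-1, 1}"]) (simp_all add: w)
    then show ?thesis by (simp add: G_def n)
  qed
  have H: "H t = 2 / ((real p + 2) * (real p + 4)) * sqrt (1 - (\<delta> * t)\<^sup>2) ^ (p + 4) *
      (\<Sum>j. gegenbauer j (lam + 2) (\<delta> * t) / gegenbauer j (lam + 2) 1
        * gegenbauer (j + 2) lam t * \<rho> ^ (j + 2))" if t: "t \<in> {-1..1}" for t
  proof -
    have "\<bar>\<delta>\<bar> * \<bar>t\<bar> \<le> \<bar>\<delta>\<bar> * 1"
      using t by (intro mult_left_mono) auto
    then have "1 - (\<delta> * t)\<^sup>2 > 0"
      using \<delta> by (simp add: abs_mult abs_square_less_1)
    then have R: "(1 - \<delta>\<^sup>2 * t\<^sup>2) powr ((real n + 1) / 2) = sqrt (1 - (\<delta> * t)\<^sup>2) ^ (p + 4)"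
      using powr_half_of_nat[of "1 - (\<delta> * t)\<^sup>2" "p + 4"] by (simp add: n power_mult_distrib add_ac)
    have l: "(real n + 2) / 2 = lam + 2" "(real n - 2) / 2 = lam"
      by (simp_all add: n lam_def field_simps)
    \<comment> \<open>With this value of the Pochhammer base, the factor (k-2)!/(n+2)_(k-2) is the
      reciprocal of C_(k-2) at 1, so it normalises the polynomial in
      \<open>\<delta> * t\<close>.\<close>
    have l2: "2 * (lam + 2) = real n + 2"
      by (simp add: n lam_def)
    have "fact j / pochhammer (real n + 2) j = 1 / gegenbauer j (lam + 2) 1" for j
      by (simp only: gegenbauer_at_1 l2 divide_divide_eq_right mult_1)
    moreover have "(real n)\<^sup>2 - 1 = (real p + 2) * (real p + 4)"
      by (simp add: n power2_eq_square algebra_simps)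
    ultimately show ?thesis
      unfolding H_def R l by simp
  qed
  have "convex_on {-1..1} (\<lambda>t. F t + G t + 2 / ((real p + 2) * (real p + 4)) * sqrt (1 - (\<delta> * t)\<^sup>2) ^ (p + 4) *
      (\<Sum>j. gegenbauer j (lam + 2) (\<delta> * t) / gegenbauer j (lam + 2) 1
        * gegenbauer (j + 2) lam t * \<rho> ^ (j + 2)))"
    unfolding F G lam_def using assms(2,3) \<delta> by (intro convex_on_gegenbauer_expansion) auto
  \<comment> \<open>The limit lemma for a constant sequence replaces the function by one that agrees
    with it on [-1, 1], where \<open>H\<close> is valid.\<close>
  then show ?thesis
    by (rule convex_on_limit[where f = "\<lambda>_. _"]) (simp add: H)
qed

end
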